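(* Assume Martin's Axiom. Let $\hat p=\{p_n:n\in\omega\}$ with $p_n\in(0,\tfrac12]$ and $\lim_{n\to\infty}p_n=0$, and let $\{{\cal F}_\xi:\xi<\lambda\}$, where $\lambda<2^{\aleph_0}$, be a family of nonprincipal filters on $\omega$ each of which is $\mu_{\hat p}$-nonmeasurable. Then $\bigcap_{\xi<\lambda}{\cal F}_\xi$ is a Lebesgue nonmeasurable filter.
   Context: Subsets of $\omega$ are identified with their characteristic functions, so filters on $\omega$ are subsets of $2^\omega$. $\mu_{\hat p}$ is the product measure on $2^\omega$ with $\mu_{\hat p}(\{x:x(n)=1\})=p_n$ and $\mu_{\hat p}(\{x:x(n)=0\})=1-p_n$; Lebesgue measure on $2^\omega$ is the case $p_n=\tfrac12$ for all $n$. *)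

theory Defs
  imports "HOL-Probability.Probability" "HOL-Library.Equipollence"
begin

text \<open>Posets are represented with carrier a subset of the reals: every poset of
size less than the continuum is isomorphic to one of these, so this version of MA
is implied by MA and implies MA restricted to posets of size below the continuum,
which is equivalent to MA.\<close>

definition compatible :: "real set \<Rightarrow> (real \<Rightarrow> real \<Rightarrow> bool) \<Rightarrow> real \<Rightarrow> real \<Rightarrow> bool" where
  "compatible P le p q \<longleftrightarrow> (\<exists>r\<in>P. le r p \<and> le r q)"

definition antichain :: "real set \<Rightarrow> (real \<Rightarrow> real \<Rightarrow> bool) \<Rightarrow> real set \<Rightarrow> bool" where
  "antichain P le A \<longleftrightarrow> A \<subseteq> P \<and> (\<forall>p\<in>A. \<forall>q\<in>A. p \<noteq> q \<longrightarrow> \<not> compatible P le p q)"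

definition ccc :: "real set \<Rightarrow> (real \<Rightarrow> real \<Rightarrow> bool) \<Rightarrow> bool" where
  "ccc P le \<longleftrightarrow> (\<forall>A. antichain P le A \<longrightarrow> countable A)"

definition partial_order_on_set :: "real set \<Rightarrow> (real \<Rightarrow> real \<Rightarrow> bool) \<Rightarrow> bool" where
  "partial_order_on_set P le \<longleftrightarrow>
     (\<forall>p\<in>P. le p p) \<and>
     (\<forall>p\<in>P. \<forall>q\<in>P. \<forall>r\<in>P. le p q \<longrightarrow> le q r \<longrightarrow> le p r) \<and>
     (\<forall>p\<in>P. \<forall>q\<in>P. le p q \<longrightarrow> le q p \<longrightarrow> p = q)"

definition dense_in :: "real set \<Rightarrow> (real \<Rightarrow> real \<Rightarrow> bool) \<Rightarrow> real set \<Rightarrow> bool" where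
  "dense_in P le D \<longleftrightarrow> D \<subseteq> P \<and> (\<forall>p\<in>P. \<exists>d\<in>D. le d p)"

definition poset_filter :: "real set \<Rightarrow> (real \<Rightarrow> real \<Rightarrow> bool) \<Rightarrow> real set \<Rightarrow> bool" where
  "poset_filter P le G \<longleftrightarrow> G \<subseteq> P \<and> G \<noteq> {} \<and>
     (\<forall>p\<in>G. \<forall>q\<in>P. le p q \<longrightarrow> q \<in> G) \<and>
     (\<forall>p\<in>G. \<forall>q\<in>G. \<exists>r\<in>G. le r p \<and> le r q)"

definition martin_axiom :: bool where
  "martin_axiom \<longleftrightarrow>
     (\<forall>(P::real set) le (\<D>::real set set).
        P \<noteq> {} \<and> partial_order_on_set P le \<and> ccc P le \<and>
        (\<forall>D\<in>\<D>. dense_in P le D) \<and> \<D> \<prec> (UNIV::real set)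
        \<longrightarrow> (\<exists>G. poset_filter P le G \<and> (\<forall>D\<in>\<D>. G \<inter> D \<noteq> {})))"

definition is_filter :: "nat set set \<Rightarrow> bool" where
  "is_filter F \<longleftrightarrow> UNIV \<in> F \<and> {} \<notin> F \<and>
     (\<forall>A\<in>F. \<forall>B. A \<subseteq> B \<longrightarrow> B \<in> F) \<and>
     (\<forall>A\<in>F. \<forall>B\<in>F. A \<inter> B \<in> F)"

definition nonprincipal_filter :: "nat set set \<Rightarrow> bool" where
  "nonprincipal_filter F \<longleftrightarrow> is_filter F \<and> (\<forall>A. finite (- A) \<longrightarrow> A \<in> F)"

definition mu_p :: "(nat \<Rightarrow> real) \<Rightarrow> (nat \<Rightarrow> bool) measure" where
  "mu_p p = PiM UNIV (\<lambda>n. measure_pmf (bernoulli_pmf (p n)))"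

definition lebesgue_cantor :: "(nat \<Rightarrow> bool) measure" where
  "lebesgue_cantor = mu_p (\<lambda>n. 1/2)"

definition char_set :: "nat set set \<Rightarrow> (nat \<Rightarrow> bool) set" where
  "char_set F = {x. {n. x n} \<in> F}"

definition measurable_wrt :: "(nat \<Rightarrow> bool) measure \<Rightarrow> nat set set \<Rightarrow> bool" where
  "measurable_wrt M F \<longleftrightarrow> char_set F \<in> sets (completion M)"

end

theory Submission
  imports Defs
begin

text \<open>
  Let \<open>G\<close> be the intersection. If \<open>G\<close> is measurable, it is null, and then it is null for a local
  reason: there are finite blocks \<open>U n\<close> and upward closed families \<open>B n\<close> of subsets of \<open>U n\<close> of
  measure at most \<open>(1/2) ^ n\<close> such that every member of \<open>G\<close> has a trace in \<open>B n\<close> for infinitely many \<open>n\<close>.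
  It remains to find a member of all the \<open>F \<xi>\<close> whose traces avoid \<open>B n\<close> for almost all \<open>n\<close>.

  Since \<open>p\<close> tends to 0, finite unions of \<open>p\<close>-random sets are still much sparser than Lebesgue
  random ones, and a transfinite recursion selects \<open>Y \<xi> \<in> F \<xi>\<close> whose finite unions avoid \<open>B\<close>
  robustly. There is no reason why the poset adding one \<open>B\<close>-avoiding set that almost contains all
  the \<open>Y \<xi>\<close> should be ccc. So, using Martin's Axiom, one first covers all the families
  \<open>{z. z \<union> (finite union of Y's) \<in> B n}\<close> by one sequence \<open>B' n\<close>, still small, and selects
  \<open>Z \<xi> \<in> F \<xi>\<close> in the same way with \<open>B'\<close> in place of \<open>B\<close>. For \<open>X \<xi> = Y \<xi> \<inter> Z \<xi> \<in> F \<xi>\<close> and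
  finite sets \<open>E\<close>, \<open>E'\<close> of indices, \<open>\<Union>(X ` E) \<union> \<Union>(X ` E')\<close> lies in \<open>\<Union>(Y ` E) \<union> \<Union>(Z ` E')\<close> and so
  avoids \<open>B\<close>. Hence any two conditions with the same stem are compatible, and a second application of
  Martin's Axiom yields one \<open>B\<close>-avoiding set almost containing every \<open>X \<xi>\<close>.
\<close>

section \<open>Consequences of Martin's Axiom\<close>

text \<open>\<open>martin_axiom\<close> speaks of posets on sets of reals, so the poset is copied
  there along an injection and the generic filter is pulled back. The dense sets form a family
  indexed by \<open>K\<close> and are met within \<open>Q\<close>; of the filter only directedness
  is kept.\<close>

lemma martin_axiom_transfer:
  fixes Q :: "'q set" and le :: "'q \<Rightarrow> 'q \<Rightarrow> bool" and K :: "'k set" and D :: "'k \<Rightarrow> 'q set"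
  assumes MA: martin_axiom
    and ne: "Q \<noteq> {}" and small: "Q \<lesssim> (UNIV::real set)"
    and refl: "\<And>x. x \<in> Q \<Longrightarrow> le x x"
    and trans: "\<And>x y z. \<lbrakk>x \<in> Q; y \<in> Q; z \<in> Q; le x y; le y z\<rbrakk> \<Longrightarrow> le x z"
    and antisym: "\<And>x y. \<lbrakk>x \<in> Q; y \<in> Q; le x y; le y x\<rbrakk> \<Longrightarrow> x = y"
    and ccc: "\<And>A. \<lbrakk>A \<subseteq> Q; \<And>x y. \<lbrakk>x \<in> A; y \<in> A; x \<noteq> y\<rbrakk> \<Longrightarrow> \<not> (\<exists>z\<in>Q. le z x \<and> le z y)\<rbrakk> \<Longrightarrow> countable A"
    and K: "K \<prec> (UNIV::real set)"
    and D: "\<And>k x. \<lbrakk>k \<in> K; x \<in> Q\<rbrakk> \<Longrightarrow> \<exists>d\<in>D k \<inter> Q. le d x"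
  obtains G where "G \<subseteq> Q" "\<And>k. k \<in> K \<Longrightarrow> G \<inter> D k \<noteq> {}"
    "\<And>x y. \<lbrakk>x \<in> G; y \<in> G\<rbrakk> \<Longrightarrow> \<exists>z\<in>G. le z x \<and> le z y"
proof -
  obtain e :: "'q \<Rightarrow> real" where e: "inj_on e Q"
    using small unfolding lepoll_def by blast
  define d where "d = inv_into Q e"
  have de [simp]: "d (e x) = x" if "x \<in> Q" for x
    using e that by (simp add: d_def)
  define P where "P = e ` Q"
  define le' where "le' x y = le (d x) (d y)" for x y
  define \<D> where "\<D> = (\<lambda>k. e ` (D k \<inter> Q)) ` K"
  have "ccc P le'"
    unfolding ccc_def
  proof (intro allI impI)
    fix A assume A: "antichain P le' A"
    have AP: "A \<subseteq> e ` Q" using A by (simp add: antichain_def P_def)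
    have "countable (d ` A)"
    proof (rule ccc)
      show "d ` A \<subseteq> Q" using AP by auto
      fix x y assume "x \<in> d ` A" "y \<in> d ` A" "x \<noteq> y"
      then obtain u v where uv: "x = d u" "y = d v" "u \<in> A" "v \<in> A" "u \<noteq> v" by blast
      then have "\<not> compatible P le' u v" using A by (auto simp: antichain_def)
      then show "\<not> (\<exists>z\<in>Q. le z x \<and> le z y)"
        by (auto simp: compatible_def P_def le'_def uv)
    qed
    moreover have "A = e ` (d ` A)" using AP by (force simp: image_image)
    ultimately show "countable A" by (metis countable_image)
  qed
  moreover have "partial_order_on_set P le'"
    unfolding partial_order_on_set_def P_def le'_def
    by (auto intro: refl dest: trans antisym)
  moreover have "dense_in P le' X" if "X \<in> \<D>" for X
    using that D unfolding dense_in_def P_def le'_def \<D>_def by fastforce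
  moreover have "\<D> \<prec> (UNIV::real set)"
    using K image_lepoll lesspoll_trans1 unfolding \<D>_def by blast
  moreover have "P \<noteq> {}" using ne by (simp add: P_def)
  ultimately obtain G where G: "poset_filter P le' G" "\<And>X. X \<in> \<D> \<Longrightarrow> G \<inter> X \<noteq> {}"
    using MA unfolding martin_axiom_def by meson
  have GP: "G \<subseteq> e ` Q" using G by (auto simp: poset_filter_def P_def)
  show thesis
  proof (rule that[of "d ` G"])
    show "d ` G \<subseteq> Q" using GP by auto
    show "d ` G \<inter> D k \<noteq> {}" if "k \<in> K" for k
    proof -
      have "G \<inter> e ` (D k \<inter> Q) \<noteq> {}" using G(2) that by (auto simp: \<D>_def)
      then show ?thesis by (force simp: image_iff)
    qed
    show "\<exists>z\<in>d ` G. le z x \<and> le z y" if "x \<in> d ` G" "y \<in> d ` G" for x y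
      using that G(1) by (auto simp: poset_filter_def le'_def)
  qed
qed

text \<open>Bounds the size of the poset used for uniformization. A pair is coded by the set of all
  triples (coded list, \<open>n\<close>, traces below \<open>n\<close>), a subset of one fixed
  countable set.\<close>

lemma lists_times_Fpow_lepoll_real:
  fixes C :: "'c set" and I :: "'i set"
  assumes C: "countable C" and I: "I \<lesssim> (UNIV::real set)"
  shows "lists C \<times> Fpow I \<lesssim> (UNIV::real set)"
proof -
  have "I \<lesssim> (UNIV::nat set set)"
    using I nat_sets_eqpoll_reals by (metis eqpoll_sym lepoll_trans2)
  then obtain f :: "'i \<Rightarrow> nat set" where f: "inj_on f I"
    unfolding lepoll_def by blast
  define g where "g = to_nat_on C"
  have g: "inj_on g C" using C by (simp add: g_def inj_on_to_nat_on)
  define tr where "tr E n = (\<lambda>i. f i \<inter> {..<n}) ` E" for E :: "'i set" and n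
  \<comment> \<open>A finite set of subsets of \<open>\<nat>\<close> is determined by its traces on the sets \<open>{..<n}\<close>.\<close>
  have tr: "i \<in> E \<longleftrightarrow> (\<forall>n. f i \<inter> {..<n} \<in> tr E n)" if "finite E" "E \<subseteq> I" "i \<in> I" for i E
  proof
    assume *: "\<forall>n. f i \<inter> {..<n} \<in> tr E n"
    then have "\<exists>j. j \<in> E \<and> f i \<inter> {..<n} = f j \<inter> {..<n}" for n
      by (auto simp: tr_def)
    then obtain j where j: "\<And>n. j n \<in> E" "\<And>n. f i \<inter> {..<n} = f (j n) \<inter> {..<n}"
      by metis
    \<comment> \<open>Since \<open>E\<close> is finite, one \<open>k\<close> serves infinitely many
      \<open>n\<close>, and then \<open>f i\<close> and \<open>f k\<close> agree below arbitrarily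
      large bounds.\<close>
    have "finite (range j)" using j(1) \<open>finite E\<close> by (meson finite_subset image_subsetI)
    then obtain k where k: "infinite {n. j n = k}"
      using pigeonhole_infinite[of "UNIV::nat set" j] by auto
    have "f i = f k"
    proof (rule set_eqI)
      fix m
      obtain n where "n > m" "j n = k"
        using k by (metis (mono_tags, lifting) infinite_nat_iff_unbounded mem_Collect_eq)
      then show "m \<in> f i \<longleftrightarrow> m \<in> f k"
        using j(2)[of n] by (metis IntI IntE lessThan_iff)
    qed
    moreover have "k \<in> E" using k j(1) by (metis (mono_tags, lifting) Collect_empty_eq finite.emptyI)
    ultimately show "i \<in> E" using f that by (metis inj_onD subsetD)
  qed (auto simp: tr_def)
  define h where "h = (\<lambda>(s,E). range (\<lambda>n. (map g s, n, tr E n)))"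
  have inj: "inj_on h (lists C \<times> Fpow I)"
  proof (rule inj_onI)
    fix x y assume xy: "x \<in> lists C \<times> Fpow I" "y \<in> lists C \<times> Fpow I" "h x = h y"
    obtain s E t E' where xy_eq: "x = (s, E)" "y = (t, E')" by (metis surj_pair)
    have s: "s \<in> lists C" "t \<in> lists C" and E: "E \<in> Fpow I" "E' \<in> Fpow I" and eq: "h (s,E) = h (t,E')"
      using xy xy_eq by auto
    have 1: "map g s = map g t" using eq by (auto simp: h_def)
    have 2: "tr E n = tr E' n" for n
    proof -
      have "(map g s, n, tr E n) \<in> h (t,E')" unfolding eq[symmetric] by (auto simp: h_def)
      then show ?thesis by (auto simp: h_def)
    qed
    have "s = t" using 1 s g by (intro map_inj_on[OF 1] inj_on_subset[OF g]) auto
    moreover have "E = E'"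
    proof (rule set_eqI)
      fix i show "i \<in> E \<longleftrightarrow> i \<in> E'"
        using tr[of E i] tr[of E' i] E 2 by (auto simp: Fpow_def)
    qed
    ultimately show "x = y" by (simp add: xy_eq)
  qed
  define T where "T = (UNIV :: nat list set) \<times> (UNIV :: nat set) \<times> {X :: nat set set. finite X \<and> X \<subseteq> {Y. finite Y}}"
  have "countable {X :: nat set set. finite X \<and> X \<subseteq> Collect finite}"
    by (rule countable_Collect_finite_subset[OF countable_Collect_finite])
  then have T: "countable T"
    unfolding T_def by (simp add: countable_SIGMA)
  have "h x \<subseteq> T" if "x \<in> lists C \<times> Fpow I" for x
    using that by (auto simp: h_def T_def tr_def Fpow_def)
  then have "lists C \<times> Fpow I \<lesssim> Pow T"
    using inj unfolding lepoll_def by blast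
  also have "Pow T \<lesssim> (UNIV::nat set set)"
    using T inj_on_image_Pow[OF inj_on_to_nat_on[OF T]] unfolding lepoll_def by blast
  also have "(UNIV::nat set set) \<approx> (UNIV::real set)" by (rule nat_sets_eqpoll_reals)
  finally show ?thesis .
qed

text \<open>Counts the dense sets of the uniformization poset: one for each \<open>i \<in> I\<close>
  and one for each stem length. Two cardinals below an infinite cardinal have their sum below
  it.\<close>

lemma countable_Plus_lesspoll_real:
  assumes "I \<prec> (UNIV::real set)"
  shows "I <+> (UNIV::nat set) \<prec> (UNIV::real set)"
proof -
  have conv: "X \<prec> (UNIV::real set) \<longleftrightarrow> ordLess2 (card_of X) (card_of (UNIV::real set))" for X :: "'x set"
  proof -
    have "ordLess2 (card_of X) (card_of (UNIV::real set)) \<longleftrightarrow> \<not> (UNIV::real set) \<lesssim> X"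
      unfolding lepoll_def by (rule card_of_ordLess[symmetric])
    moreover have "ordLess2 (card_of X) (card_of (UNIV::real set)) \<Longrightarrow> X \<lesssim> (UNIV::real set)"
      unfolding lepoll_def card_of_ordLeq by (rule ordLess_imp_ordLeq)
    moreover have "X \<prec> (UNIV::real set) \<longleftrightarrow> X \<lesssim> (UNIV::real set) \<and> \<not> (UNIV::real set) \<lesssim> X"
      unfolding lesspoll_def using lepoll_antisym eqpoll_imp_lepoll eqpoll_sym by blast
    ultimately show ?thesis by blast
  qed
  have "(UNIV::nat set) \<prec> (UNIV::real set)"
    using lesspoll_Pow_self[of "UNIV::nat set"] nat_sets_eqpoll_reals lesspoll_eq_trans by (metis Pow_UNIV)
  then show ?thesis
    using assms card_of_Plus_ordLess_infinite[OF infinite_UNIV_char_0, of I "UNIV::nat set"]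
    unfolding conv by (simp add: Plus_def)
qed


text \<open>The poset consists of pairs of a finite initial segment of \<open>c\<close> and a finite \<open>E \<subseteq> I\<close> admissible
  (\<open>G n E\<close>) beyond that segment. It is ccc because \<open>amalg\<close> makes any two conditions with the same
  segment compatible.\<close>

lemma martin_axiom_uniformization:
  fixes I :: "'i set" and C :: "'c set"
    and G :: "nat \<Rightarrow> 'i set \<Rightarrow> bool" and Good :: "nat \<Rightarrow> 'c \<Rightarrow> 'i set \<Rightarrow> bool"
  assumes MA: martin_axiom and I: "I \<prec> (UNIV::real set)" and C: "countable C"
    and G: "\<And>E. \<lbrakk>finite E; E \<subseteq> I\<rbrakk> \<Longrightarrow> \<forall>\<^sub>F n in sequentially. G n E"
    and amalg: "\<And>n E E'. \<lbrakk>finite E; E \<subseteq> I; finite E'; E' \<subseteq> I; G n E; G n E'\<rbrakk> \<Longrightarrow> \<exists>c\<in>C. Good n c E \<and> Good n c E'"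
    and anti: "\<And>n c E E'. \<lbrakk>Good n c E'; E \<subseteq> E'\<rbrakk> \<Longrightarrow> Good n c E"
  obtains c where "\<And>E. \<lbrakk>finite E; E \<subseteq> I\<rbrakk> \<Longrightarrow> \<forall>\<^sub>F n in sequentially. Good n (c n) E"
proof -
  define Q where "Q = {(s, E). s \<in> lists C \<and> E \<in> Fpow I \<and> (\<forall>n\<ge>length s. G n E)}"
  \<comment> \<open>A stronger condition end-extends the stem, and the appended values must be good
    for the promise \<open>E\<close> made earlier.\<close>
  define le where "le = (\<lambda>(s', E') (s, E). take (length s) s' = s \<and> length s \<le> length s' \<and> E \<subseteq> E' \<and>
      (\<forall>n. length s \<le> n \<longrightarrow> n < length s' \<longrightarrow> Good n (s' ! n) E))"
  \<comment> \<open>\<open>Inl i\<close> asks that \<open>i\<close> enter the promise,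
    \<open>Inr n\<close> that the stem be longer than \<open>n\<close>.\<close>
  define D where "D = case_sum (\<lambda>i. {(s::'c list, E). i \<in> E}) (\<lambda>n. {(s, E::'i set). n < length s})"
  \<comment> \<open>Serves twice: with \<open>E = E'\<close> it gives density, with two promises
    over one stem it gives compatibility. The new stem reaches \<open>N1\<close>, from where
    \<open>E''\<close> is admissible.\<close>
  have ext: "\<exists>t. (t, E'') \<in> Q \<and> N \<le> length t \<and> le (t, E'') (s, E) \<and> le (t, E'') (s, E')"
    if Q: "(s, E) \<in> Q" "(s, E') \<in> Q" and E'': "finite E''" "E'' \<subseteq> I" "E \<subseteq> E''" "E' \<subseteq> E''" for s E E' E'' N
  proof -
    obtain N1 where N1: "\<And>n. n \<ge> N1 \<Longrightarrow> G n E''"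
      using G[OF E''(1,2)] by (auto simp: eventually_sequentially)
    have "\<exists>c\<in>C. Good n c E \<and> Good n c E'" if "n \<ge> length s" for n
      using amalg[of E E' n] Q that by (auto simp: Q_def Fpow_def)
    then obtain c where c: "\<And>n. n \<ge> length s \<Longrightarrow> c n \<in> C \<and> Good n (c n) E \<and> Good n (c n) E'"
      by metis
    define M where "M = max (length s) (max N N1)"
    define t where "t = s @ map c [length s..<M]"
    have t: "length t = M" "take (length s) t = s" "length s \<le> M"
      by (auto simp: t_def M_def)
    have tn: "t ! n = c n" if "length s \<le> n" "n < M" for n
      using that by (simp add: t_def nth_append)
    have "t \<in> lists C" using Q c by (auto simp: Q_def t_def)
    then have "(t, E'') \<in> Q" using N1 E'' by (auto simp: Q_def t Fpow_def M_def)
    moreover have "le (t, E'') (s, E)" "le (t, E'') (s, E')"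
      using c E'' by (auto simp: le_def t tn)
    ultimately show ?thesis by (intro exI[of _ t]) (auto simp: t M_def)
  qed
  have Qne: "Q \<noteq> {}"
  proof -
    \<comment> \<open>Even the empty promise is admissible only from some \<open>N\<close> on, so
      the first condition needs a stem of length \<open>N\<close>, with arbitrary entries.\<close>
    obtain N where N: "\<And>n. n \<ge> N \<Longrightarrow> G n {}"
      using G[of "{}"] by (auto simp: eventually_sequentially)
    then obtain c where "c \<in> C" using amalg[of "{}" "{}" N] by auto
    then have "(replicate N c, {}) \<in> Q" using N by (auto simp: Q_def Fpow_def)
    then show ?thesis by blast
  qed
  have lists: "countable (lists C)"
    using C by simp
  obtain H where H: "H \<subseteq> Q" "\<And>k. k \<in> I <+> UNIV \<Longrightarrow> H \<inter> D k \<noteq> {}"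
    "\<And>x y. \<lbrakk>x \<in> H; y \<in> H\<rbrakk> \<Longrightarrow> \<exists>z\<in>H. le z x \<and> le z y"
  proof (rule martin_axiom_transfer[of Q le "I <+> (UNIV::nat set)" D])
    have "Q \<subseteq> lists C \<times> Fpow I" by (auto simp: Q_def)
    then show "Q \<lesssim> (UNIV::real set)"
      using lists_times_Fpow_lepoll_real[OF C lesspoll_imp_lepoll[OF I]]
      by (meson lepoll_trans subset_imp_lepoll)
    show "le x x" if "x \<in> Q" for x
      using that by (auto simp: le_def)
    show "le x z" if "le x y" "le y z" for x y z
    proof -
      obtain s E t E' u E'' where eq: "x = (s, E)" "y = (t, E')" "z = (u, E'')"
        by (metis surj_pair)
      have 1: "take (length t) s = t" "length t \<le> length s" "take (length u) t = u" "length u \<le> length t"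
        using that by (auto simp: le_def eq)
      have "take (length u) s = take (length u) (take (length t) s)"
        using 1(4) by (simp only: take_take min.absorb1)
      also have "\<dots> = u" by (subst 1(1)) (rule 1(3))
      finally have "take (length u) s = u" .
      moreover have "Good n (s ! n) E''" if n: "length u \<le> n" "n < length s" for n
      proof (cases "n < length t")
        case True
        then have "s ! n = t ! n" using 1 by (metis nth_take)
        then show ?thesis using True n \<open>le y z\<close> by (auto simp: le_def eq)
      next
        case False
        then have "Good n (s ! n) E'" "E'' \<subseteq> E'" using n \<open>le x y\<close> \<open>le y z\<close> by (auto simp: le_def eq)
        then show ?thesis by (rule anti)
      qed
      ultimately show ?thesis using that 1 by (auto simp: le_def eq)
    qed
    show "x = y" if "le x y" "le y x" for x y
      using that by (auto simp: le_def)
    show "countable A" if A: "A \<subseteq> Q"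
      and anti: "\<And>x y. \<lbrakk>x \<in> A; y \<in> A; x \<noteq> y\<rbrakk> \<Longrightarrow> \<not> (\<exists>z\<in>Q. le z x \<and> le z y)" for A
    proof -
      \<comment> \<open>An antichain has at most one condition per stem, and there are only
        countably many stems.\<close>
      have "inj_on fst A"
      proof (rule inj_onI, rule ccontr)
        fix x y assume xy: "x \<in> A" "y \<in> A" "fst x = fst y" "x \<noteq> y"
        then obtain s E E' where eq: "x = (s, E)" "y = (s, E')" by (metis prod.collapse)
        have "(s, E) \<in> Q" "(s, E') \<in> Q" using xy A eq by auto
        moreover from this have "finite (E \<union> E')" "E \<union> E' \<subseteq> I" by (auto simp: Q_def Fpow_def)
        ultimately show False using ext[of s E E' "E \<union> E'"] anti[of x y] xy eq by blast
      qed
      moreover have "countable (fst ` A)"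
        by (rule countable_subset[OF _ lists]) (use A in \<open>auto simp: Q_def\<close>)
      ultimately show ?thesis using countable_image_inj_on by blast
    qed
    show "\<exists>d\<in>D k \<inter> Q. le d x" if k: "k \<in> I <+> UNIV" and x: "x \<in> Q" for k x
    proof -
      obtain s E where eq: "x = (s, E)" by (metis surj_pair)
      have sE: "(s, E) \<in> Q" using x eq by simp
      then have E: "finite E" "E \<subseteq> I" by (auto simp: Q_def Fpow_def)
      from k consider i where "k = Inl i" "i \<in> I" | n where "k = Inr n" by blast
      then show ?thesis
      proof cases
        case 1
        then obtain t where "(t, insert i E) \<in> Q" "le (t, insert i E) (s, E)"
          using ext[OF sE sE, of "insert i E"] E by auto
        then show ?thesis using 1 eq by (auto simp: D_def)
      next
        case 2
        then obtain t where "(t, E) \<in> Q" "Suc n \<le> length t" "le (t, E) (s, E)"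
          using ext[OF sE sE, of E "Suc n"] E by auto
        then show ?thesis using 2 eq by (auto simp: D_def)
      qed
    qed
  qed (use MA Qne countable_Plus_lesspoll_real[OF I] in auto)
  have "\<exists>x\<in>H. n < length (fst x)" for n
    using H(2)[of "Inr n"] by (force simp: D_def)
  then obtain x where x: "\<And>n. x n \<in> H" "\<And>n. n < length (fst (x n))" by metis
  \<comment> \<open>Stems in \<open>H\<close> have common end-extensions, so the choice of
    \<open>x n\<close> does not affect the value.\<close>
  define c where "c n = fst (x n) ! n" for n
  have mem: "\<exists>y\<in>H. E \<subseteq> snd y" if "finite E" "E \<subseteq> I" for E
    using that
  proof (induction E rule: finite_induct)
    case empty
    then show ?case using x(1)[of 0] by (intro bexI[of _ "x 0"]) auto
  next
    case (insert i E)
    then obtain y where y: "y \<in> H" "E \<subseteq> snd y" by auto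
    obtain y' where y': "y' \<in> H" "i \<in> snd y'"
      using H(2)[of "Inl i"] insert.prems by (force simp: D_def)
    obtain z where "z \<in> H" "le z y" "le z y'" using H(3)[OF y(1) y'(1)] by blast
    then have "snd y \<subseteq> snd z" "snd y' \<subseteq> snd z" by (auto simp: le_def)
    then show ?case using y y' \<open>z \<in> H\<close> by blast
  qed
  show thesis
  proof (rule that)
    fix E assume "finite E" "E \<subseteq> I"
    then obtain y where "y \<in> H" "E \<subseteq> snd y" using mem by blast
    then obtain s E' where y: "(s, E') \<in> H" "E \<subseteq> E'" by (metis prod.collapse)
    have "Good n (c n) E" if "n \<ge> length s" for n
    proof -
      \<comment> \<open>In the stem of \<open>z\<close> the value \<open>c n\<close> stands beyond
        \<open>s\<close>, so it had to respect the promise \<open>E'\<close>.\<close>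
      obtain z where z: "z \<in> H" "le z (x n)" "le z (s, E')" using H(3)[OF x(1) y(1)] by blast
      then have "take (length (fst (x n))) (fst z) = fst (x n)" "length (fst (x n)) \<le> length (fst z)"
        by (auto simp: le_def)
      then have "fst z ! n = c n" "n < length (fst z)"
        using x(2)[of n] nth_take[of n "length (fst (x n))" "fst z"] by (simp_all add: c_def)
      then have "Good n (c n) E'" using z(3) that by (auto simp: le_def)
      then show ?thesis using y anti by blast
    qed
    then show "\<forall>\<^sub>F n in sequentially. Good n (c n) E"
      by (auto simp: eventually_sequentially)
  qed
qed

section \<open>Biased random subsets of a finite set\<close>

text \<open>The expectation of \<open>f A\<close> for a random \<open>A \<subseteq> U\<close> that
  contains each \<open>i\<close> independently with probability \<open>p i\<close>. As a finite sum
  it allows the bias to vary without a change of measure space.\<close>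

definition bexp :: "(nat \<Rightarrow> real) \<Rightarrow> nat set \<Rightarrow> (nat set \<Rightarrow> real) \<Rightarrow> real" where
  "bexp p U f = (\<Sum>A\<in>Pow U. (\<Prod>i\<in>A. p i) * (\<Prod>i\<in>U - A. 1 - p i) * f A)"

lemma bexp_empty [simp]: "bexp p {} f = f {}"
  by (simp add: bexp_def)

lemma bexp_insert:
  assumes "finite U" "i \<notin> U"
  shows "bexp p (insert i U) f = p i * bexp p U (\<lambda>A. f (insert i A)) + (1 - p i) * bexp p U f"
proof -
  let ?g = "\<lambda>V A. (\<Prod>j\<in>A. p j) * (\<Prod>j\<in>V - A. 1 - p j)"
  have inj: "inj_on (insert i) (Pow U)" using assms by (auto simp: inj_on_def)
  have "bexp p (insert i U) f = (\<Sum>A\<in>Pow U. ?g (insert i U) A * f A) + (\<Sum>A\<in>insert i ` Pow U. ?g (insert i U) A * f A)"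
    unfolding bexp_def Pow_insert using assms by (intro sum.union_disjoint) auto
  also have "(\<Sum>A\<in>insert i ` Pow U. ?g (insert i U) A * f A) = (\<Sum>A\<in>Pow U. p i * (?g U A * f (insert i A)))"
    unfolding sum.reindex[OF inj] o_def
  proof (rule sum.cong[OF refl])
    fix A assume "A \<in> Pow U"
    then have "i \<notin> A" "finite A" "insert i U - insert i A = U - A" using assms by (auto intro: finite_subset)
    then show "?g (insert i U) (insert i A) * f (insert i A) = p i * (?g U A * f (insert i A))" by simp
  qed
  also have "(\<Sum>A\<in>Pow U. ?g (insert i U) A * f A) = (\<Sum>A\<in>Pow U. (1 - p i) * (?g U A * f A))"
  proof (rule sum.cong[OF refl])
    fix A assume "A \<in> Pow U"
    then have "insert i U - A = insert i (U - A)" "i \<notin> U - A" using assms by auto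
    then show "?g (insert i U) A * f A = (1 - p i) * (?g U A * f A)" using assms by simp
  qed
  finally show ?thesis
    by (simp add: bexp_def sum_distrib_left)
qed

lemma bexp_cong:
  assumes "\<And>A. A \<subseteq> U \<Longrightarrow> f A = g A" "\<And>i. i \<in> U \<Longrightarrow> p i = q i"
  shows "bexp p U f = bexp q U g"
proof -
  have "(\<Prod>i\<in>A. p i) = (\<Prod>i\<in>A. q i)" "(\<Prod>i\<in>U - A. 1 - p i) = (\<Prod>i\<in>U - A. 1 - q i)" if "A \<subseteq> U" for A
    using that assms(2) by (auto intro!: prod.cong)
  then show ?thesis unfolding bexp_def using assms(1) by (intro sum.cong) auto
qed

lemma bexp_mono:
  assumes "\<And>i. i \<in> U \<Longrightarrow> 0 \<le> p i \<and> p i \<le> 1" "\<And>A. A \<subseteq> U \<Longrightarrow> f A \<le> g A"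
  shows "bexp p U f \<le> bexp p U g"
  unfolding bexp_def using assms
  by (intro sum_mono mult_left_mono mult_nonneg_nonneg prod_nonneg) auto

lemma bexp_add: "bexp p U (\<lambda>A. f A + g A) = bexp p U f + bexp p U g"
  by (simp add: bexp_def algebra_simps sum.distrib)

lemma bexp_cmult: "bexp p U (\<lambda>A. c * f A) = c * bexp p U f"
  by (simp add: bexp_def sum_distrib_left mult_ac)

lemma bexp_multc: "bexp p U (\<lambda>A. f A * c) = bexp p U f * c"
  unfolding bexp_def sum_distrib_right by (simp only: mult.assoc)

lemma bexp_sum: "bexp p U (\<lambda>A. \<Sum>s\<in>S. f s A) = (\<Sum>s\<in>S. bexp p U (f s))"
  unfolding bexp_def sum_distrib_left by (rule sum.swap)

lemma bexp_const: "finite U \<Longrightarrow> bexp p U (\<lambda>_. c) = c"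
  by (induction U rule: finite_induct) (simp_all add: bexp_insert algebra_simps)

lemma bexp_le_const:
  assumes "finite U" "\<And>i. i \<in> U \<Longrightarrow> 0 \<le> p i \<and> p i \<le> 1" "\<And>A. A \<subseteq> U \<Longrightarrow> f A \<le> c"
  shows "bexp p U f \<le> c"
  using bexp_mono[of U p f "\<lambda>_. c"] assms by (simp add: bexp_const)

lemma bexp_nonneg:
  assumes "\<And>i. i \<in> U \<Longrightarrow> 0 \<le> p i \<and> p i \<le> 1" "\<And>A. A \<subseteq> U \<Longrightarrow> 0 \<le> f A"
  shows "0 \<le> bexp p U f"
  unfolding bexp_def using assms
  by (intro sum_nonneg mult_nonneg_nonneg prod_nonneg) auto

lemma bexp_Un:
  assumes "finite U" "finite V" "U \<inter> V = {}"
  shows "bexp p (U \<union> V) f = bexp p U (\<lambda>A. bexp p V (\<lambda>B. f (A \<union> B)))"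
  using assms
  by (induction U arbitrary: f rule: finite_induct) (simp_all add: bexp_insert)

lemma bexp_swap:
  "bexp p U (\<lambda>A. bexp q V (\<lambda>B. f A B)) = bexp q V (\<lambda>B. bexp p U (\<lambda>A. f A B))"
proof -
  have "bexp p U (\<lambda>A. bexp q V (f A)) =
    (\<Sum>A\<in>Pow U. \<Sum>B\<in>Pow V. ((\<Prod>i\<in>A. p i) * (\<Prod>i\<in>U - A. 1 - p i)) * (((\<Prod>i\<in>B. q i) * (\<Prod>i\<in>V - B. 1 - q i)) * f A B))"
    by (simp add: bexp_def sum_distrib_left)
  also have "\<dots> = (\<Sum>B\<in>Pow V. \<Sum>A\<in>Pow U. ((\<Prod>i\<in>A. p i) * (\<Prod>i\<in>U - A. 1 - p i)) * (((\<Prod>i\<in>B. q i) * (\<Prod>i\<in>V - B. 1 - q i)) * f A B))"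
    by (rule sum.swap)
  also have "\<dots> = bexp q V (\<lambda>B. bexp p U (\<lambda>A. f A B))"
    by (simp add: bexp_def sum_distrib_left mult_ac)
  finally show ?thesis .
qed

text \<open>The union of independent random sets with biases \<open>p\<close> and \<open>r\<close>
  is random with bias \<open>p + r - p * r\<close>; for monotone \<open>f\<close>, raising the bias
  to \<open>q\<close> raises the expectation. Both are done at once by induction on
  \<open>U\<close>.\<close>

lemma bexp_union_le:
  assumes "finite U" "\<And>i. i \<in> U \<Longrightarrow> 0 \<le> p i \<and> p i \<le> 1 \<and> 0 \<le> r i \<and> r i \<le> 1 \<and> p i + r i - p i * r i \<le> q i \<and> q i \<le> 1"
    and "\<And>A B. A \<subseteq> B \<Longrightarrow> f A \<le> f B"
  shows "bexp p U (\<lambda>A. bexp r U (\<lambda>B. f (A \<union> B))) \<le> bexp q U f"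
  using assms
proof (induction U arbitrary: f rule: finite_induct)
  case (insert i U)
  have q: "0 \<le> q j \<and> q j \<le> 1" if "j \<in> U" for j
  proof -
    have "0 \<le> p j + (1 - p j) * r j" using insert.prems(1)[of j] that by auto
    then show ?thesis using insert.prems(1)[of j] that by (auto simp: algebra_simps)
  qed
  have m: "f (insert i A) \<le> f (insert i B)" if "A \<subseteq> B" for A B
    by (rule insert.prems(2)) (use that in auto)
  let ?E = "\<lambda>g. bexp p U (\<lambda>A. bexp r U (\<lambda>B. g (A \<union> B)))"
  let ?f = "\<lambda>A. f (insert i A)"
  have "bexp p (insert i U) (\<lambda>A. bexp r (insert i U) (\<lambda>B. f (A \<union> B))) =
      p i * r i * ?E ?f + p i * (1 - r i) * ?E ?f + (1 - p i) * r i * ?E ?f + (1 - p i) * (1 - r i) * ?E f"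
    using insert.hyps by (simp add: bexp_insert bexp_add bexp_cmult) (simp add: algebra_simps)
  also have "\<dots> = (p i + r i - p i * r i) * ?E ?f + (1 - (p i + r i - p i * r i)) * ?E f"
    by (simp add: algebra_simps)
  also have "\<dots> \<le> (p i + r i - p i * r i) * bexp q U ?f + (1 - (p i + r i - p i * r i)) * bexp q U f"
  proof (intro add_mono mult_left_mono)
    show "?E ?f \<le> bexp q U ?f" by (rule insert.IH) (use insert.prems m in auto)
    show "?E f \<le> bexp q U f" by (rule insert.IH) (use insert.prems in auto)
    have "0 \<le> p i + (1 - p i) * r i" using insert.prems(1)[of i] by auto
    then show "0 \<le> p i + r i - p i * r i" by (simp add: algebra_simps)
    show "0 \<le> 1 - (p i + r i - p i * r i)" using insert.prems(1)[of i] by auto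
  qed
  \<comment> \<open>Affine in the bias of \<open>i\<close>, with nonnegative slope by monotonicity,
    so that bias may be raised to \<open>q i\<close>.\<close>
  also have "\<dots> = bexp q U f + (p i + r i - p i * r i) * (bexp q U ?f - bexp q U f)"
    by (simp add: algebra_simps)
  also have "\<dots> \<le> bexp q U f + q i * (bexp q U ?f - bexp q U f)"
  proof (intro add_left_mono mult_right_mono)
    show "0 \<le> bexp q U ?f - bexp q U f"
      using bexp_mono[OF q, where f = f and g = ?f] insert.prems(2) by (auto simp: subset_insertI)
  qed (use insert.prems(1)[of i] in auto)
  also have "\<dots> = bexp q (insert i U) f"
    using insert.hyps by (simp add: bexp_insert algebra_simps)
  finally show ?case .
qed simp

text \<open>The case \<open>r = 0\<close> of the union inequality: a random set of bias 0 is
  empty.\<close>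

lemma bexp_bias_mono:
  assumes "finite U" "\<And>i. i \<in> U \<Longrightarrow> 0 \<le> p i \<and> p i \<le> q i \<and> q i \<le> 1"
    and "\<And>A B. A \<subseteq> B \<Longrightarrow> f A \<le> f B"
  shows "bexp p U f \<le> bexp q U f"
proof -
  have "bexp (\<lambda>_. 0) U g = g {}" for g
    using assms(1) by (induction U arbitrary: g rule: finite_induct) (simp_all add: bexp_insert)
  then have "bexp p U f = bexp p U (\<lambda>A. bexp (\<lambda>_. 0) U (\<lambda>B. f (A \<union> B)))"
    by simp
  also have "\<dots> \<le> bexp q U f"
    by (rule bexp_union_le[OF assms(1) _ assms(3)]) (use assms(2) in force)+
  finally show ?thesis .
qed

text \<open>Intersecting independent random sets multiplies their biases.\<close>

lemma bexp_inter:
  assumes "finite U"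
  shows "bexp p U (\<lambda>A. bexp r U (\<lambda>B. f (A \<inter> B))) = bexp (\<lambda>i. p i * r i) U f"
  using assms
proof (induction U arbitrary: f rule: finite_induct)
  case (insert i U)
  have *: "bexp p U (\<lambda>A. bexp r U (\<lambda>B. g (insert i A) B)) = bexp p U (\<lambda>A. bexp r U (\<lambda>B. g' A B))"
    if "\<And>A B. A \<subseteq> U \<Longrightarrow> B \<subseteq> U \<Longrightarrow> g (insert i A) B = g' A B" for g g' :: "nat set \<Rightarrow> nat set \<Rightarrow> real"
    using that by (intro bexp_cong) auto
  have 1: "bexp p U (\<lambda>A. bexp r U (\<lambda>B. f (insert i A \<inter> B))) = bexp p U (\<lambda>A. bexp r U (\<lambda>B. f (A \<inter> B)))"
    using insert.hyps(2) by (intro * ) (auto intro!: arg_cong[where f = f])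
  have 2: "bexp p U (\<lambda>A. bexp r U (\<lambda>B. f (A \<inter> insert i B))) = bexp p U (\<lambda>A. bexp r U (\<lambda>B. f (A \<inter> B)))"
    using insert.hyps(2) by (intro bexp_cong) (auto intro!: arg_cong[where f = f])
  have 3: "bexp p U (\<lambda>A. bexp r U (\<lambda>B. f (insert i A \<inter> insert i B))) = bexp p U (\<lambda>A. bexp r U (\<lambda>B. f (insert i (A \<inter> B))))"
  proof -
    have "insert i A \<inter> insert i B = insert i (A \<inter> B)" for A B by auto
    then show ?thesis by (simp only:)
  qed
  show ?case
    using insert.hyps insert.IH[of f] insert.IH[of "\<lambda>A. f (insert i A)"]
    by (simp add: bexp_insert bexp_add bexp_cmult 1 2 3 del: Int_insert_left Int_insert_right) (simp add: algebra_simps)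
qed simp

text \<open>A random set of bias \<open>p ^ D\<close> is the intersection of \<open>D\<close>
  independent ones of bias \<open>p\<close>; if the intersection is in the upward closed
  \<open>B\<close>, so are all \<open>D\<close> of them.\<close>

lemma bexp_power_le:
  assumes U: "finite U" and p: "\<And>i. i \<in> U \<Longrightarrow> 0 \<le> p i \<and> p i \<le> 1"
    and up: "\<And>A A'. A \<in> B \<Longrightarrow> A \<subseteq> A' \<Longrightarrow> A' \<subseteq> U \<Longrightarrow> A' \<in> B"
  shows "bexp (\<lambda>i. p i ^ D) U (\<lambda>A. of_bool (A \<in> B)) \<le> bexp p U (\<lambda>A. of_bool (A \<in> B)) ^ D"
proof (induction D)
  case 0
  then show ?case using bexp_le_const[OF U, of "\<lambda>_. 1"] by simp
next
  case (Suc D)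
  let ?b = "\<lambda>A. of_bool (A \<in> B) :: real"
  have pD: "0 \<le> p i ^ D \<and> p i ^ D \<le> 1" if "i \<in> U" for i
    using p[OF that] by (simp add: power_le_one)
  have "bexp (\<lambda>i. p i ^ Suc D) U ?b = bexp p U (\<lambda>A. bexp (\<lambda>i. p i ^ D) U (\<lambda>A'. ?b (A \<inter> A')))"
    using bexp_inter[OF U, of p "\<lambda>i. p i ^ D" ?b] by simp
  also have "\<dots> \<le> bexp p U (\<lambda>A. bexp (\<lambda>i. p i ^ D) U (\<lambda>A'. ?b A * ?b A'))"
  proof (intro bexp_mono p pD)
    fix A A' assume "A \<subseteq> U" "A' \<subseteq> U"
    then have "A \<in> B \<and> A' \<in> B" if "A \<inter> A' \<in> B" using up that by blast
    then show "?b (A \<inter> A') \<le> ?b A * ?b A'" by auto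
  qed
  also have "\<dots> = bexp (\<lambda>i. p i ^ D) U ?b * bexp p U ?b"
    by (simp only: bexp_cmult bexp_multc mult.commute)
  also have "\<dots> \<le> bexp p U ?b ^ D * bexp p U ?b"
    by (intro mult_right_mono Suc.IH bexp_nonneg p) auto
  finally show ?case by (simp add: mult.commute)
qed

lemma bexp_markov:
  assumes "\<And>i. i \<in> U \<Longrightarrow> 0 \<le> p i \<and> p i \<le> 1" "\<And>A. A \<subseteq> U \<Longrightarrow> 0 \<le> f A" "0 < t"
  shows "bexp p U (\<lambda>A. of_bool (t \<le> f A)) \<le> bexp p U f / t"
proof -
  have "bexp p U (\<lambda>A. of_bool (t \<le> f A)) \<le> bexp p U (\<lambda>A. (1 / t) * f A)"
    using assms by (intro bexp_mono) auto
  then show ?thesis unfolding bexp_cmult by simp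
qed

section \<open>Events of the product measure that depend on finitely many coordinates\<close>

lemma space_mu_p [simp]: "space (mu_p p) = UNIV"
  by (simp add: mu_p_def space_PiM)

lemma prob_space_mu_p: "prob_space (mu_p p)"
  unfolding mu_p_def by (intro prob_space_PiM measure_pmf.prob_space_axioms)

lemma sets_mu_p_trace [measurable]: "finite U \<Longrightarrow> {x. {i \<in> U. x i} \<in> C} \<in> sets (mu_p p)"
proof -
  assume U: "finite U"
  have "(\<lambda>x. x i) \<in> measurable (mu_p p) (measure_pmf (bernoulli_pmf (p i)))" for i
    unfolding mu_p_def by (rule measurable_component_singleton) simp
  from measurable_sets[OF this, of "{True}"] measurable_sets[OF this, of "{False}"]
  have 1: "{x. x i} \<in> sets (mu_p p)" "{x. \<not> x i} \<in> sets (mu_p p)" for i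
    by (simp_all add: vimage_def)
  have 2: "{x. {i \<in> U. x i} = A} \<in> sets (mu_p p)" for A
  proof (cases "A \<subseteq> U")
    case True
    then have "{x. {i \<in> U. x i} = A} = {x \<in> space (mu_p p). \<forall>i\<in>U. x i \<longleftrightarrow> i \<in> A}"
      by auto
    also have "\<dots> \<in> sets (mu_p p)"
    proof (rule sets.sets_Collect_finite_All[OF _ U])
      fix i show "{x \<in> space (mu_p p). x i \<longleftrightarrow> i \<in> A} \<in> sets (mu_p p)"
        using 1[of i] by (cases "i \<in> A") auto
    qed
    finally show ?thesis .
  next
    case False
    then have "{x. {i \<in> U. x i} = A} = {}" by auto
    then show ?thesis by simp
  qed
  have "{x. {i \<in> U. x i} \<in> C} = (\<Union>A\<in>C \<inter> Pow U. {x. {i \<in> U. x i} = A})" by auto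
  also have "\<dots> \<in> sets (mu_p p)" using U 2 by (intro sets.finite_UN) auto
  finally show ?thesis .
qed

lemma measure_mu_p_trace:
  assumes U: "finite U" and p: "\<And>n. 0 \<le> p n \<and> p n \<le> 1"
  shows "measure (mu_p p) {x. {i \<in> U. x i} \<in> C} = bexp p U (\<lambda>A. of_bool (A \<in> C))"
proof -
  interpret M: prob_space "mu_p p" by (rule prob_space_mu_p)
  interpret P: product_prob_space "\<lambda>n. measure_pmf (bernoulli_pmf (p n))" UNIV
    by unfold_locales
  have single: "measure (mu_p p) {x. {i \<in> U. x i} = A} = (\<Prod>i\<in>A. p i) * (\<Prod>i\<in>U - A. 1 - p i)" if "A \<subseteq> U" for A
  proof -
    have "{x. {i \<in> U. x i} = A} =
        prod_emb UNIV (\<lambda>n. measure_pmf (bernoulli_pmf (p n))) U (PiE U (\<lambda>i. {i \<in> A}))"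
      using that by (auto simp: prod_emb_def PiE_iff)
    then have "measure (mu_p p) {x. {i \<in> U. x i} = A} = (\<Prod>i\<in>U. measure (measure_pmf (bernoulli_pmf (p i))) {i \<in> A})"
      unfolding mu_p_def using U by (simp add: P.measure_PiM_emb)
    also have "\<dots> = (\<Prod>i\<in>U. if i \<in> A then p i else 1 - p i)"
      using p by (intro prod.cong) (auto simp: measure_pmf_single)
    also have "\<dots> = (\<Prod>i\<in>A. p i) * (\<Prod>i\<in>U - A. 1 - p i)"
      using U that by (subst prod.If_cases) (auto simp: Int_absorb1 Diff_eq)
    finally show ?thesis .
  qed
  have "{x. {i \<in> U. x i} \<in> C} = (\<Union>A\<in>C \<inter> Pow U. {x. {i \<in> U. x i} = A})" by auto
  also have "measure (mu_p p) \<dots> = (\<Sum>A\<in>C \<inter> Pow U. measure (mu_p p) {x. {i \<in> U. x i} = A})"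
    using U sets_mu_p_trace[OF U, of "{A}" for A]
    by (intro M.finite_measure_finite_Union) (auto simp: disjoint_family_on_def)
  also have "\<dots> = (\<Sum>A\<in>C \<inter> Pow U. (\<Prod>i\<in>A. p i) * (\<Prod>i\<in>U - A. 1 - p i))"
    using single by (intro sum.cong) auto
  also have "\<dots> = bexp p U (\<lambda>A. of_bool (A \<in> C))"
    unfolding bexp_def using U by (intro sum.mono_neutral_cong_left) auto
  finally show ?thesis .
qed

section \<open>Sparse families of members of nonmeasurable filters\<close>

text \<open>A subset of a null set belongs to the completion. Nonmeasurability of the filters enters
  the proof only in this form.\<close>

lemma nonmeasurable_avoids_null:
  assumes "\<not> measurable_wrt M F" "N \<in> null_sets M"
  obtains x where "x \<in> char_set F" "x \<notin> N"
proof -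
  have "\<not> char_set F \<subseteq> N"
  proof
    assume "char_set F \<subseteq> N"
    then have "char_set F \<in> null_sets (completion M)"
      using assms(2) null_sets_completion_subset null_sets_completionI by blast
    then show False using assms(1) by (auto simp: measurable_wrt_def)
  qed
  then show thesis using that by blast
qed

text \<open>Borel-Cantelli. The factor 2 leaves room for families \<open>c n\<close> that are unions
  of two families of measure at most \<open>(1/2) ^ n\<close>.\<close>

lemma null_limsup_traces:
  assumes U: "\<And>n. finite (U n)" and p: "\<And>n. 0 \<le> p n \<and> p n \<le> 1"
    and small: "\<forall>\<^sub>F n in sequentially. bexp p (U n) (\<lambda>A. of_bool (A \<in> c n)) \<le> 2 * (1/2) ^ n"
  shows "limsup (\<lambda>n. {x. {i \<in> U n. x i} \<in> c n}) \<in> null_sets (mu_p p)"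
proof (rule borel_cantelli_limsup1)
  interpret prob_space "mu_p p" by (rule prob_space_mu_p)
  show "{x. {i \<in> U n. x i} \<in> c n} \<in> sets (mu_p p)" for n
    using U by (rule sets_mu_p_trace)
  show "emeasure (mu_p p) {x. {i \<in> U n. x i} \<in> c n} < \<infinity>" for n
    by (simp add: emeasure_eq_measure)
  show "summable (\<lambda>n. measure (mu_p p) {x. {i \<in> U n. x i} \<in> c n})"
    unfolding measure_mu_p_trace[OF U p]
  proof (rule summable_comparison_test_ev)
    show "\<forall>\<^sub>F n in sequentially. norm (bexp p (U n) (\<lambda>A. of_bool (A \<in> c n))) \<le> 2 * (1/2) ^ n"
      using small by eventually_elim (simp add: bexp_nonneg p)
    show "summable (\<lambda>n. 2 * (1/2::real) ^ n)"
      by (intro summable_mult summable_geometric) simp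
  qed
qed

text \<open>\<open>B n\<close> is the family of traces on the block \<open>U n\<close> to be
  avoided. A random set of bias \<open>p\<close> is eventually dominated on the blocks by one of
  constant bias \<open>\<beta> n\<close>.\<close>

locale biased_blocks =
  fixes p :: "nat \<Rightarrow> real" and U :: "nat \<Rightarrow> nat set" and B :: "nat \<Rightarrow> nat set set" and \<beta> :: "nat \<Rightarrow> real"
  assumes p: "0 \<le> p n \<and> p n \<le> 1"
    and fin [simp]: "finite (U n)"
    and up: "\<lbrakk>A \<in> B n; A \<subseteq> A'; A' \<subseteq> U n\<rbrakk> \<Longrightarrow> A' \<in> B n"
    and \<beta>_nonneg: "0 \<le> \<beta> n"
    and p_le_\<beta>: "\<forall>\<^sub>F n in sequentially. \<forall>i\<in>U n. p i \<le> \<beta> n"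
begin

text \<open>The chance that \<open>Y\<close> enters \<open>B n\<close> after the addition of a
  random set whose bias bounds that of a union of \<open>D\<close> random sets of bias
  \<open>\<beta> n\<close>. The minimum with 1 keeps the bias a probability.\<close>

definition hit :: "nat \<Rightarrow> nat \<Rightarrow> nat set \<Rightarrow> real" where
  "hit n D Y = bexp (\<lambda>_. min 1 (real D * \<beta> n)) (U n) (\<lambda>A. of_bool ((A \<union> Y) \<inter> U n \<in> B n))"

text \<open>Quantifying over all \<open>D\<close> makes this stable: adding one
  \<open>p\<close>-random set uses the bound at \<open>Suc D\<close> to get the one at
  \<open>D\<close>, and the quotient of these bounds is the summable
  \<open>(1/2) ^ n\<close>.\<close>

definition sparse :: "nat set \<Rightarrow> bool" where
  "sparse Y \<longleftrightarrow> (\<forall>D. \<forall>\<^sub>F n in sequentially. hit n D Y \<le> (1/2) ^ (D * n))"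

lemma bias: "0 \<le> min 1 (real D * \<beta> n) \<and> min 1 (real D * \<beta> n) \<le> 1"
  using \<beta>_nonneg by simp

lemma hits_mono:
  "A \<subseteq> A' \<Longrightarrow> (of_bool ((A \<union> Y) \<inter> U n \<in> B n) :: real) \<le> of_bool ((A' \<union> Y) \<inter> U n \<in> B n)"
  using up[of "(A \<union> Y) \<inter> U n" n "(A' \<union> Y) \<inter> U n"] by auto

lemma hit_mono: "Y \<subseteq> Y' \<Longrightarrow> hit n D Y \<le> hit n D Y'"
  unfolding hit_def using up[of "(A \<union> Y) \<inter> U n" n "(A \<union> Y') \<inter> U n" for A]
  by (intro bexp_mono bias) auto

lemma hit_nonneg: "0 \<le> hit n D Y"
  unfolding hit_def by (intro bexp_nonneg bias) auto

lemma hit_bias_mono: "D \<le> D' \<Longrightarrow> hit n D Y \<le> hit n D' Y"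
proof -
  assume "D \<le> D'"
  then have "min 1 (real D * \<beta> n) \<le> min 1 (real D' * \<beta> n)"
    by (intro min.mono mult_right_mono \<beta>_nonneg) auto
  then show ?thesis
    unfolding hit_def using bias[of D n] bias[of D' n] by (intro bexp_bias_mono hits_mono) auto
qed

lemma hit_trace: "hit n D (Y \<union> Z) = hit n D (Y \<union> Z \<inter> U n)"
proof -
  have "(A \<union> (Y \<union> Z)) \<inter> U n = (A \<union> (Y \<union> Z \<inter> U n)) \<inter> U n" for A by auto
  then show ?thesis by (simp only: hit_def)
qed

lemma sparse_mono: "\<lbrakk>sparse Y'; Y \<subseteq> Y'\<rbrakk> \<Longrightarrow> sparse Y"
  unfolding sparse_def using hit_mono order_trans by (meson eventually_mono)

text \<open>Averaging over an additional \<open>p\<close>-random set costs one unit of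
  \<open>D\<close>, because \<open>p\<close> is at most \<open>\<beta> n\<close> on the
  block.\<close>

lemma hit_step:
  assumes "\<forall>i\<in>U n. p i \<le> \<beta> n"
  shows "bexp p (U n) (\<lambda>A. hit n D (Y \<union> A)) \<le> hit n (Suc D) Y"
proof -
  let ?f = "\<lambda>A. of_bool ((A \<union> Y) \<inter> U n \<in> B n) :: real"
  have *: "(B \<union> (Y \<union> A)) = ((A \<union> B) \<union> Y)" for A B by auto
  have "p i + min 1 (real D * \<beta> n) - p i * min 1 (real D * \<beta> n) \<le> min 1 (real (Suc D) * \<beta> n)" if "i \<in> U n" for i
  proof -
    let ?r = "min 1 (real D * \<beta> n)"
    \<comment> \<open>The first product bounds the bias of the union by the sum of the biases, the
      second bounds it by 1.\<close>
    have "0 \<le> p i * ?r" "0 \<le> (1 - p i) * (1 - ?r)"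
      using p[of i] bias[of D n] by auto
    moreover have "p i \<le> \<beta> n" using assms that by blast
    ultimately show ?thesis using bias[of D n] by (auto simp: algebra_simps)
  qed
  then have "bexp p (U n) (\<lambda>A. bexp (\<lambda>_. min 1 (real D * \<beta> n)) (U n) (\<lambda>B. ?f (A \<union> B)))
    \<le> bexp (\<lambda>_. min 1 (real (Suc D) * \<beta> n)) (U n) ?f"
    using p bias[of D n] bias[of "Suc D" n] by (intro bexp_union_le hits_mono) (auto simp del: of_nat_Suc)
  then show ?thesis by (simp only: hit_def *)
qed

text \<open>\<open>\<gamma>\<close> is the bias at which \<open>B\<close> is known to be small. Bias
  \<open>D * \<beta>\<close> is below \<open>\<gamma> ^ D\<close>, which by
  \<open>bexp_power_le\<close> brings the measure of \<open>B n\<close> down to the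
  \<open>D\<close>-th power.\<close>

lemma sparse_empty:
  assumes \<gamma>: "\<And>n. 0 \<le> \<gamma> n \<and> \<gamma> n \<le> 1"
    and small: "\<forall>\<^sub>F n in sequentially. bexp (\<lambda>_. \<gamma> n) (U n) (\<lambda>A. of_bool (A \<in> B n)) \<le> (1/2) ^ n"
    and dom: "\<And>D. \<forall>\<^sub>F n in sequentially. real D * \<beta> n \<le> \<gamma> n ^ D"
  shows "sparse {}"
  unfolding sparse_def
proof
  fix D
  show "\<forall>\<^sub>F n in sequentially. hit n D {} \<le> (1/2) ^ (D * n)"
    using small dom[of D]
  proof eventually_elim
    case (elim n)
    have "hit n D {} \<le> bexp (\<lambda>_. \<gamma> n ^ D) (U n) (\<lambda>A. of_bool ((A \<union> {}) \<inter> U n \<in> B n))"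
      unfolding hit_def using elim(2) \<gamma>[of n] \<beta>_nonneg[of n]
      by (intro bexp_bias_mono hits_mono) (auto simp: power_le_one)
    also have "\<dots> = bexp (\<lambda>_. \<gamma> n ^ D) (U n) (\<lambda>A. of_bool (A \<in> B n))"
      by (intro bexp_cong) (auto simp: Int_absorb2)
    also have "\<dots> \<le> bexp (\<lambda>_. \<gamma> n) (U n) (\<lambda>A. of_bool (A \<in> B n)) ^ D"
      by (rule bexp_power_le) (use \<gamma> up in auto)
    also have "\<dots> \<le> ((1/2) ^ n) ^ D"
      using elim(1) \<gamma> by (intro power_mono bexp_nonneg) auto
    finally show ?case by (simp add: power_mult[symmetric] mult.commute)
  qed
qed

text \<open>For each \<open>D\<close>, Markov's inequality with \<open>hit_step\<close> shows that
  the traces spoiling the bound at \<open>D\<close> have measure at most \<open>(1/2) ^ n\<close>.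
  Martin's Axiom covers these families for all finite \<open>E\<close> by one sequence, whose limsup
  is null. \<open>F\<close> has a member outside these null sets for all \<open>D\<close>
  simultaneously.\<close>

lemma sparse_extend:
  fixes X :: "'i \<Rightarrow> nat set" and I :: "'i set"
  assumes MA: martin_axiom and I: "I \<prec> (UNIV::real set)"
    and X: "\<And>E. \<lbrakk>finite E; E \<subseteq> I\<rbrakk> \<Longrightarrow> sparse (\<Union>(X ` E))"
    and F: "\<not> measurable_wrt (mu_p p) F"
  obtains Z where "Z \<in> F" "\<And>E. \<lbrakk>finite E; E \<subseteq> I\<rbrakk> \<Longrightarrow> sparse (\<Union>(X ` E) \<union> Z)"
proof -
  define bad where "bad D n E = {z. z \<subseteq> U n \<and> (1/2) ^ (D * n) \<le> hit n D (\<Union>(X ` E) \<union> z)}" for D n E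
  \<comment> \<open>Ranging over all \<open>E0 \<subseteq> E\<close> makes \<open>Good\<close> pass
    to smaller promises; the factor 2 allows two bad families to be joined.\<close>
  define Good where "Good D n c E \<longleftrightarrow> bexp p (U n) (\<lambda>A. of_bool (A \<in> c)) \<le> 2 * (1/2) ^ n \<and> (\<forall>E0\<subseteq>E. bad D n E0 \<subseteq> c)"
    for D n c and E :: "'i set"
  have "\<exists>c. \<forall>E. finite E \<longrightarrow> E \<subseteq> I \<longrightarrow> (\<forall>\<^sub>F n in sequentially. Good D n (c n) E)" for D
  proof -
    define G where "G n E \<longleftrightarrow> hit n (Suc D) (\<Union>(X ` E)) \<le> (1/2) ^ (Suc D * n) \<and> (\<forall>i\<in>U n. p i \<le> \<beta> n)" for n and E :: "'i set"
    have small: "bexp p (U n) (\<lambda>A. of_bool (A \<in> bad D n E)) \<le> (1/2) ^ n" if "G n E" for n E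
    proof -
      have "bexp p (U n) (\<lambda>A. of_bool (A \<in> bad D n E)) =
          bexp p (U n) (\<lambda>A. of_bool ((1/2) ^ (D * n) \<le> hit n D (\<Union>(X ` E) \<union> A)))"
        by (intro bexp_cong) (auto simp: bad_def)
      also have "\<dots> \<le> bexp p (U n) (\<lambda>A. hit n D (\<Union>(X ` E) \<union> A)) / (1/2) ^ (D * n)"
        by (intro bexp_markov p hit_nonneg) simp
      also have "\<dots> \<le> (1/2) ^ (Suc D * n) / (1/2) ^ (D * n)"
        using that hit_step[of n D "\<Union>(X ` E)"] unfolding G_def by (intro divide_right_mono) auto
      also have "\<dots> = (1/2) ^ n" by (simp add: power_add)
      finally show ?thesis .
    qed
    have "\<exists>c. \<forall>E. finite E \<longrightarrow> E \<subseteq> I \<longrightarrow> (\<forall>\<^sub>F n in sequentially. Good D n (c n) E)"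
    proof (rule martin_axiom_uniformization[OF MA I, of "{c. finite c \<and> c \<subseteq> Collect finite}" G "Good D"])
      show "countable {c :: nat set set. finite c \<and> c \<subseteq> Collect finite}"
        by (rule countable_Collect_finite_subset[OF countable_Collect_finite])
      show "\<forall>\<^sub>F n in sequentially. G n E" if "finite E" "E \<subseteq> I" for E
      proof -
        have "\<forall>\<^sub>F n in sequentially. hit n (Suc D) (\<Union>(X ` E)) \<le> (1/2) ^ (Suc D * n)"
          using X[OF that] unfolding sparse_def by blast
        then show ?thesis unfolding G_def using p_le_\<beta> by (rule eventually_conj)
      qed
      show "Good D n c E" if "Good D n c E'" "E \<subseteq> E'" for n c E E'
        using that by (auto simp: Good_def)
      show "\<exists>c\<in>{c. finite c \<and> c \<subseteq> Collect finite}. Good D n c E \<and> Good D n c E'" if G: "G n E" "G n E'" for n E E'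
      proof (intro bexI conjI)
        let ?c = "bad D n E \<union> bad D n E'"
        have "bexp p (U n) (\<lambda>A. of_bool (A \<in> ?c)) \<le> bexp p (U n) (\<lambda>A. of_bool (A \<in> bad D n E) + of_bool (A \<in> bad D n E'))"
          by (intro bexp_mono p) auto
        also have "\<dots> \<le> 2 * (1/2) ^ n"
          unfolding bexp_add using small[OF G(1)] small[OF G(2)] by simp
        finally have *: "bexp p (U n) (\<lambda>A. of_bool (A \<in> ?c)) \<le> 2 * (1/2) ^ n" .
        have "bad D n E0 \<subseteq> bad D n E1" if "E0 \<subseteq> E1" for E0 E1
        proof -
          have "hit n D (\<Union>(X ` E0) \<union> z) \<le> hit n D (\<Union>(X ` E1) \<union> z)" for z
            by (rule hit_mono) (use that in blast)
          then show ?thesis unfolding bad_def using order_trans by blast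
        qed
        then show "Good D n ?c E" "Good D n ?c E'"
          using * unfolding Good_def by blast+
        have "?c \<subseteq> Pow (U n)" by (auto simp: bad_def)
        then show "?c \<in> {c. finite c \<and> c \<subseteq> Collect finite}"
          using finite_subset[of ?c "Pow (U n)"] by (auto intro: finite_subset[OF _ fin])
      qed
    qed blast
    then show ?thesis .
  qed
  then obtain c where c: "\<And>D E. \<lbrakk>finite E; E \<subseteq> I\<rbrakk> \<Longrightarrow> \<forall>\<^sub>F n in sequentially. Good D n (c D n) E"
    by metis
  define N where "N D = limsup (\<lambda>n. {x. {i \<in> U n. x i} \<in> c D n})" for D
  have "N D \<in> null_sets (mu_p p)" for D
    unfolding N_def using c[of "{}" D] by (intro null_limsup_traces p fin) (auto simp: Good_def elim: eventually_mono)
  then have "(\<Union>D. N D) \<in> null_sets (mu_p p)" by (rule null_sets_UN)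
  then obtain x where "x \<in> char_set F" "x \<notin> (\<Union>D. N D)"
    by (rule nonmeasurable_avoids_null[OF F])
  then have x: "x \<in> char_set F" "\<And>D. x \<notin> N D" by auto
  define Z where "Z = {n. x n}"
  have Z: "\<forall>\<^sub>F n in sequentially. Z \<inter> U n \<notin> c D n" for D
  proof -
    have "{i \<in> U n. x i} = Z \<inter> U n" for n by (auto simp: Z_def)
    \<comment> \<open>Not being in the limsup means that the traces lie in \<open>c D n\<close> for
      only finitely many \<open>n\<close>.\<close>
    then show ?thesis using x(2)[of D] by (auto simp: N_def limsup_INF_SUP eventually_sequentially)
  qed
  show thesis
  proof (rule that)
    show "Z \<in> F" using x(1) by (simp add: char_set_def Z_def)
    fix E assume E: "finite E" "E \<subseteq> I"
    show "sparse (\<Union>(X ` E) \<union> Z)"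
      unfolding sparse_def
    proof
      fix D
      show "\<forall>\<^sub>F n in sequentially. hit n D (\<Union>(X ` E) \<union> Z) \<le> (1/2) ^ (D * n)"
        using Z[of D] c[OF E, of D]
      proof eventually_elim
        case (elim n)
        then have "Z \<inter> U n \<notin> bad D n E" by (auto simp: Good_def)
        then show ?case unfolding bad_def by (simp add: hit_trace[of n D _ Z])
      qed
    qed
  qed
qed

text \<open>Recursion along a well-order of the index type, with \<open>sparse_extend\<close>
  applied to the fewer than continuum many sets chosen before. Any nonempty finite set of indices is
  handled at its greatest element.\<close>

lemma sparse_family:
  fixes F :: "'i \<Rightarrow> nat set set" and I :: "'i set"
  assumes MA: martin_axiom and I: "I \<prec> (UNIV::real set)"
    and empty: "sparse {}"
    and F: "\<And>\<xi>. \<xi> \<in> I \<Longrightarrow> \<not> measurable_wrt (mu_p p) (F \<xi>)"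
  obtains X where "\<And>\<xi>. \<xi> \<in> I \<Longrightarrow> X \<xi> \<in> F \<xi>" "\<And>E. \<lbrakk>finite E; E \<subseteq> I\<rbrakk> \<Longrightarrow> sparse (\<Union>(X ` E))"
proof -
  obtain r :: "'i rel" where r: "Well_order r" "Field r = UNIV" using well_ordering[where 'a = 'i] by (elim exE conjE)
  define R where "R = r - Id"
  have wf: "wf R" using r by (simp add: R_def well_order_on_def)
  have lin: "(\<eta>, \<xi>) \<in> R \<or> \<eta> = \<xi> \<or> (\<xi>, \<eta>) \<in> R" for \<eta> \<xi>
    using r unfolding well_order_on_def linear_order_on_def total_on_def R_def by auto
  have tr: "trans R"
    using r unfolding well_order_on_def linear_order_on_def partial_order_on_def preorder_on_def R_def
    by (auto intro: trans_diff_Id)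
  have greatest: "\<exists>m\<in>E. \<forall>x\<in>E. x = m \<or> (x, m) \<in> R" if "finite E" "E \<noteq> {}" for E
    using that
  proof (induction E rule: finite_ne_induct)
    case (insert x A)
    then obtain m where "m \<in> A" "\<forall>x\<in>A. x = m \<or> (x, m) \<in> R" by blast
    then show ?case using lin[of x m] tr by (metis insert_iff transD)
  qed auto
  define pre where "pre \<xi> = {\<eta> \<in> I. (\<eta>, \<xi>) \<in> R}" for \<xi>
  define step where "step f \<xi> = (SOME Z. Z \<in> F \<xi> \<and> (\<forall>E. finite E \<longrightarrow> E \<subseteq> pre \<xi> \<longrightarrow> sparse (\<Union>(f ` E) \<union> Z)))"
    for f :: "'i \<Rightarrow> nat set" and \<xi>
  define X where "X = wfrec R step"
  \<comment> \<open>The choice at \<open>\<xi>\<close> inspects values at predecessors only, so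
    cutting the function off at \<open>\<xi>\<close> changes nothing.\<close>
  have X_eq: "X \<xi> = step X \<xi>" for \<xi>
  proof -
    have "cut X R \<xi> ` E = X ` E" if "E \<subseteq> pre \<xi>" for E
      using that by (intro image_cong) (auto simp: cut_def pre_def)
    then have "step (cut X R \<xi>) \<xi> = step X \<xi>"
      unfolding step_def by (intro arg_cong[where f = Eps] ext) auto
    then show ?thesis unfolding X_def by (subst wfrec[OF wf]) simp
  qed
  have main: "\<xi> \<in> I \<longrightarrow> X \<xi> \<in> F \<xi> \<and> (\<forall>E. finite E \<longrightarrow> E \<subseteq> insert \<xi> (pre \<xi>) \<longrightarrow> sparse (\<Union>(X ` E)))" for \<xi>
    using wf
  proof (induction \<xi>)
    case (less \<xi>)
    show ?case
    proof
      assume \<xi>: "\<xi> \<in> I"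
      have sp: "sparse (\<Union>(X ` E))" if E: "finite E" "E \<subseteq> pre \<xi>" for E
      proof (cases "E = {}")
        case False
        obtain m where m: "m \<in> E" "\<forall>x\<in>E. x = m \<or> (x, m) \<in> R"
          using greatest[OF E(1) False] by blast
        then have "E \<subseteq> insert m (pre m)" using E by (auto simp: pre_def)
        moreover have "(m, \<xi>) \<in> R" "m \<in> I" using m E by (auto simp: pre_def)
        ultimately show ?thesis using less E by blast
      qed (simp add: empty)
      have "pre \<xi> \<prec> (UNIV::real set)"
        using I by (rule lesspoll_trans1[OF subset_imp_lepoll, rotated]) (auto simp: pre_def)
      then obtain Z where "Z \<in> F \<xi>" "\<And>E. finite E \<Longrightarrow> E \<subseteq> pre \<xi> \<Longrightarrow> sparse (\<Union>(X ` E) \<union> Z)"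
        using sparse_extend[OF MA _ sp F[OF \<xi>]] by blast
      then have "\<exists>Z. Z \<in> F \<xi> \<and> (\<forall>E. finite E \<longrightarrow> E \<subseteq> pre \<xi> \<longrightarrow> sparse (\<Union>(X ` E) \<union> Z))"
        by blast
      from someI_ex[OF this]
      have *: "X \<xi> \<in> F \<xi> \<and> (\<forall>E. finite E \<longrightarrow> E \<subseteq> pre \<xi> \<longrightarrow> sparse (\<Union>(X ` E) \<union> X \<xi>))"
        unfolding X_eq[of \<xi>] step_def[of X \<xi>] .
      have "sparse (\<Union>(X ` E))" if E: "finite E" "E \<subseteq> insert \<xi> (pre \<xi>)" for E
      proof (rule sparse_mono)
        show "sparse (\<Union>(X ` (E - {\<xi>})) \<union> X \<xi>)" using * E by auto
      qed auto
      then show "X \<xi> \<in> F \<xi> \<and> (\<forall>E. finite E \<longrightarrow> E \<subseteq> insert \<xi> (pre \<xi>) \<longrightarrow> sparse (\<Union>(X ` E)))"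
        using * by blast
    qed
  qed
  show thesis
  proof (rule that)
    show "X \<xi> \<in> F \<xi>" if "\<xi> \<in> I" for \<xi> using main that by blast
    fix E assume E: "finite E" "E \<subseteq> I"
    show "sparse (\<Union>(X ` E))"
    proof (cases "E = {}")
      case False
      obtain m where m: "m \<in> E" "\<forall>x\<in>E. x = m \<or> (x, m) \<in> R"
        using greatest[OF E(1) False] by blast
      then have "E \<subseteq> insert m (pre m)" using E by (auto simp: pre_def)
      then show ?thesis using main m E by blast
    qed (simp add: empty)
  qed
qed

text \<open>At bias \<open>min 1 (\<beta> n)\<close> the family \<open>bad n E\<close> has measure
  \<open>hit n 1\<close>. The stronger bound available for \<open>hit n 2\<close> leaves room to
  join two such families and still stay below \<open>(1/2) ^ n\<close>.\<close>

lemma sparse_family_cover: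
  fixes X :: "'i \<Rightarrow> nat set" and I :: "'i set"
  assumes MA: martin_axiom and I: "I \<prec> (UNIV::real set)"
    and X: "\<And>E. \<lbrakk>finite E; E \<subseteq> I\<rbrakk> \<Longrightarrow> sparse (\<Union>(X ` E))"
  obtains B' where "\<And>n A A'. \<lbrakk>A \<in> B' n; A \<subseteq> A'; A' \<subseteq> U n\<rbrakk> \<Longrightarrow> A' \<in> B' n"
    "\<forall>\<^sub>F n in sequentially. bexp (\<lambda>_. min 1 (\<beta> n)) (U n) (\<lambda>A. of_bool (A \<in> B' n)) \<le> (1/2) ^ n"
    "\<And>E. \<lbrakk>finite E; E \<subseteq> I\<rbrakk> \<Longrightarrow> \<forall>\<^sub>F n in sequentially. \<forall>z\<subseteq>U n. (z \<union> \<Union>(X ` E)) \<inter> U n \<in> B n \<longrightarrow> z \<in> B' n"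
proof -
  define bad where "bad n E = {z. z \<subseteq> U n \<and> (z \<union> \<Union>(X ` E)) \<inter> U n \<in> B n}" for n E
  define upset where "upset n c \<longleftrightarrow> (\<forall>A\<in>c. \<forall>A'. A \<subseteq> A' \<longrightarrow> A' \<subseteq> U n \<longrightarrow> A' \<in> c)" for n c
  \<comment> \<open>\<open>1 \<le> n\<close> is what makes
    \<open>2 * (1/2) ^ (2 * n) \<le> (1/2) ^ n\<close> true.\<close>
  define G where "G n E \<longleftrightarrow> hit n 2 (\<Union>(X ` E)) \<le> (1/2) ^ (2 * n) \<and> 1 \<le> n" for n E
  define Good where "Good n c E \<longleftrightarrow> upset n c \<and>
     bexp (\<lambda>_. min 1 (\<beta> n)) (U n) (\<lambda>A. of_bool (A \<in> c)) \<le> (1/2) ^ n \<and> (\<forall>E0\<subseteq>E. bad n E0 \<subseteq> c)"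
    for n c and E :: "'i set"
  have bias1: "0 \<le> min 1 (\<beta> n) \<and> min 1 (\<beta> n) \<le> 1" for n using bias[of 1 n] by simp
  have mono: "bad n E0 \<subseteq> bad n E1" if "E0 \<subseteq> E1" for E0 E1 n
    unfolding bad_def using that up[of "(z \<union> \<Union>(X ` E0)) \<inter> U n" n "(z \<union> \<Union>(X ` E1)) \<inter> U n" for z] by blast
  have small: "bexp (\<lambda>_. min 1 (\<beta> n)) (U n) (\<lambda>A. of_bool (A \<in> bad n E)) \<le> (1/2) ^ (2 * n)" if "G n E" for n E
  proof -
    have "bexp (\<lambda>_. min 1 (\<beta> n)) (U n) (\<lambda>A. of_bool (A \<in> bad n E)) = hit n 1 (\<Union>(X ` E))"
      unfolding hit_def by (intro bexp_cong) (auto simp: bad_def)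
    also have "\<dots> \<le> hit n 2 (\<Union>(X ` E))" by (rule hit_bias_mono) simp
    finally show ?thesis using that by (simp add: G_def)
  qed
  obtain c where c: "\<And>E. \<lbrakk>finite E; E \<subseteq> I\<rbrakk> \<Longrightarrow> \<forall>\<^sub>F n in sequentially. Good n (c n) E"
  proof (rule martin_axiom_uniformization[OF MA I, of "{c. finite c \<and> c \<subseteq> Collect finite}" G Good])
    show "countable {c :: nat set set. finite c \<and> c \<subseteq> Collect finite}"
      by (rule countable_Collect_finite_subset[OF countable_Collect_finite])
    show "\<forall>\<^sub>F n in sequentially. G n E" if "finite E" "E \<subseteq> I" for E
    proof -
      have "\<forall>\<^sub>F n in sequentially. hit n 2 (\<Union>(X ` E)) \<le> (1/2) ^ (2 * n)"
        using X[OF that] unfolding sparse_def by blast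
      then show ?thesis unfolding G_def using eventually_ge_at_top by (rule eventually_conj)
    qed
    show "Good n c E" if "Good n c E'" "E \<subseteq> E'" for n c E E'
      using that by (auto simp: Good_def)
    show "\<exists>c\<in>{c. finite c \<and> c \<subseteq> Collect finite}. Good n c E \<and> Good n c E'" if G: "G n E" "G n E'" for n E E'
    proof (intro bexI conjI)
      let ?c = "bad n E \<union> bad n E'"
      have "bexp (\<lambda>_. min 1 (\<beta> n)) (U n) (\<lambda>A. of_bool (A \<in> ?c)) \<le>
          bexp (\<lambda>_. min 1 (\<beta> n)) (U n) (\<lambda>A. of_bool (A \<in> bad n E) + of_bool (A \<in> bad n E'))"
        by (intro bexp_mono bias1) auto
      also have "\<dots> \<le> 2 * (1/2) ^ (2 * n)"
        unfolding bexp_add using small[OF G(1)] small[OF G(2)] by simp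
      also have "\<dots> = 2 * (1/2) ^ n * (1/2) ^ n" by (simp only: mult_2[of n] power_add mult.assoc)
      also have "\<dots> \<le> 1 * (1/2) ^ n"
      proof (rule mult_right_mono)
        have "(1/2::real) ^ n \<le> (1/2) ^ 1" using G by (intro power_decreasing) (auto simp: G_def)
        then show "2 * (1/2::real) ^ n \<le> 1" by simp
      qed simp
      finally have *: "bexp (\<lambda>_. min 1 (\<beta> n)) (U n) (\<lambda>A. of_bool (A \<in> ?c)) \<le> (1/2) ^ n" by simp
      have "upset n (bad n E)" for E
        unfolding upset_def bad_def
        using up[of "(z \<union> \<Union>(X ` E)) \<inter> U n" n "(z' \<union> \<Union>(X ` E)) \<inter> U n" for z z'] by blast
      then have "upset n ?c" unfolding upset_def by blast
      then show "Good n ?c E" "Good n ?c E'"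
        using * mono[of _ E n] mono[of _ E' n] unfolding Good_def by blast+
      have "?c \<subseteq> Pow (U n)" by (auto simp: bad_def)
      then show "?c \<in> {c. finite c \<and> c \<subseteq> Collect finite}"
        using finite_subset[of ?c "Pow (U n)"] by (auto intro: finite_subset[OF _ fin])
    qed
  qed blast
  show thesis
  \<comment> \<open>\<open>c n\<close> is known to be upward closed only eventually; the exceptional
    values are replaced by the empty family, since \<open>B'\<close> must be upward closed at every
    \<open>n\<close>.\<close>
  proof (rule that[of "\<lambda>n. if upset n (c n) then c n else {}"])
    show "A' \<in> (if upset n (c n) then c n else {})"
      if "A \<in> (if upset n (c n) then c n else {})" "A \<subseteq> A'" "A' \<subseteq> U n" for n A A'
      using that by (auto simp: upset_def split: if_splits)
    show "\<forall>\<^sub>F n in sequentially. bexp (\<lambda>_. min 1 (\<beta> n)) (U n)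
        (\<lambda>A. of_bool (A \<in> (if upset n (c n) then c n else {}))) \<le> (1/2) ^ n"
      using c[of "{}"] by (auto simp: Good_def elim!: eventually_mono)
    fix E assume "finite E" "E \<subseteq> I"
    from c[OF this] show "\<forall>\<^sub>F n in sequentially. \<forall>z\<subseteq>U n. (z \<union> \<Union>(X ` E)) \<inter> U n \<in> B n \<longrightarrow>
        z \<in> (if upset n (c n) then c n else {})"
    proof eventually_elim
      case (elim n)
      then have "bad n E \<subseteq> c n" "upset n (c n)" by (auto simp: Good_def)
      then show ?case by (auto simp: bad_def)
    qed
  qed
qed

end

section \<open>Construction of a common member of the filters that avoids the blocks\<close>

lemma intersection_avoids_blocks:
  fixes p :: "nat \<Rightarrow> real" and I :: "'i set" and F :: "'i \<Rightarrow> nat set set"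
  assumes MA: martin_axiom
    and p_range: "\<And>n. 0 < p n \<and> p n \<le> 1/2"
    and p_lim: "p \<longlonglongrightarrow> 0"
    and I: "I \<prec> (UNIV::real set)"
    and F_filt: "\<And>\<xi>. \<xi> \<in> I \<Longrightarrow> nonprincipal_filter (F \<xi>)"
    and F_nonmeas: "\<And>\<xi>. \<xi> \<in> I \<Longrightarrow> \<not> measurable_wrt (mu_p p) (F \<xi>)"
    and U: "\<And>n. finite (U n)" and far: "\<And>m. \<forall>\<^sub>F n in sequentially. \<forall>i\<in>U n. m \<le> i"
    and up: "\<And>n A A'. \<lbrakk>A \<in> B n; A \<subseteq> A'; A' \<subseteq> U n\<rbrakk> \<Longrightarrow> A' \<in> B n"
    and small: "\<forall>\<^sub>F n in sequentially. bexp (\<lambda>_. 1/2) (U n) (\<lambda>A. of_bool (A \<in> B n)) \<le> (1/2) ^ n"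
  obtains X where "\<And>\<xi>. \<xi> \<in> I \<Longrightarrow> X \<in> F \<xi>" "\<forall>\<^sub>F n in sequentially. X \<inter> U n \<notin> B n"
proof -
  \<comment> \<open>\<open>s n\<close> bounds \<open>p\<close> on \<open>U n\<close> and tends to 0
    because the blocks move to infinity. The extra element makes it positive even for an empty
    block, so that its logarithm can be used.\<close>
  define s where "s n = Max (insert (1 / real (n + 2)) (p ` U n))" for n
  define L where "L n = - ln (s n)" for n
  \<comment> \<open>An intermediate scale: \<open>s n = exp (- L n)\<close> is eventually below
    every power of \<open>\<beta> n\<close>, while \<open>\<beta> n\<close> still tends to 0. The
    first selection has biases \<open>\<beta>\<close> and \<open>1/2\<close> in the roles of
    \<open>\<beta>\<close> and \<open>\<gamma>\<close>, the second has \<open>s\<close> and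
    \<open>min 1 \<beta>\<close>.\<close>
  define \<beta> where "\<beta> n = exp (- sqrt (L n))" for n
  have p01: "0 \<le> p n \<and> p n \<le> 1" for n using p_range[of n] by linarith
  have p_le_s: "p i \<le> s n" if "i \<in> U n" for i n
    unfolding s_def using U that by (intro Max_ge) auto
  have s_pos: "0 < s n" for n
  proof -
    have "1 / real (n + 2) \<le> s n" unfolding s_def using U by (intro Max_ge) auto
    then show ?thesis by (smt (verit) divide_pos_pos of_nat_0_less_iff zero_less_numeral add_gr_0)
  qed
  have s_lim: "s \<longlonglongrightarrow> 0"
  proof (rule order_tendstoI)
    fix e :: real assume "0 < e"
    then obtain m where m: "\<And>i. i \<ge> m \<Longrightarrow> p i < e"
      using order_tendstoD(2)[OF p_lim] by (auto simp: eventually_sequentially)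
    have "(\<lambda>n. 1 / real (n + 2)) \<longlonglongrightarrow> 0"
      using LIMSEQ_ignore_initial_segment[OF lim_1_over_n[where 'a = real], of 2] by simp
    then have "\<forall>\<^sub>F n in sequentially. 1 / real (n + 2) < e"
      using \<open>0 < e\<close> by (rule order_tendstoD)
    then show "\<forall>\<^sub>F n in sequentially. s n < e"
      using far[of m]
    proof eventually_elim
      case (elim n)
      then show ?case unfolding s_def using U m by (subst Max_less_iff) auto
    qed
  qed (use s_pos in \<open>auto intro!: always_eventually intro: less_trans\<close>)
  have s_eq: "s n = exp (- L n)" for n using s_pos by (simp add: L_def)
  have L_lim: "filterlim L at_top sequentially"
  proof -
    have "filterlim s (at_right 0) sequentially"
      using s_lim s_pos less_imp_neq[OF s_pos] by (auto simp: filterlim_at intro!: always_eventually)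
    then have "filterlim (\<lambda>n. ln (s n)) at_bot sequentially"
      by (rule filterlim_compose[OF ln_at_0])
    then show ?thesis unfolding L_def by (simp add: filterlim_uminus_at_bot)
  qed
  have sqrt_lim: "filterlim (\<lambda>n. sqrt (L n)) at_top sequentially"
    by (rule filterlim_compose[OF sqrt_at_top L_lim])
  have dom_s: "\<forall>\<^sub>F n in sequentially. real D * s n \<le> \<beta> n ^ D" for D
    using filterlim_at_top[THEN iffD1, OF sqrt_lim, rule_format, of "real D + 1"]
  proof eventually_elim
    case (elim n)
    define u where "u = sqrt (L n)"
    have u: "real D + 1 \<le> u" using elim by (simp add: u_def)
    have "0 < sqrt (L n)" using elim by linarith
    then have L: "L n = u\<^sup>2" by (simp add: u_def)
    \<comment> \<open>With \<open>s n = exp (- u\<^sup>2)\<close> and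
      \<open>\<beta> n = exp (- u)\<close> the claim is
      \<open>D \<le> exp (u\<^sup>2 - D * u)\<close>, and here the exponent is already at least
      \<open>u\<close>.\<close>
    have "u * 1 \<le> u * (u - real D)" using u by (intro mult_left_mono) auto
    then have "real D \<le> u\<^sup>2 - real D * u" using u by (simp add: algebra_simps power2_eq_square)
    also have "\<dots> \<le> exp (u\<^sup>2 - real D * u)" using exp_ge_add_one_self[of "u\<^sup>2 - real D * u"] by linarith
    finally have "real D * exp (- u\<^sup>2) \<le> exp (u\<^sup>2 - real D * u) * exp (- u\<^sup>2)"
      by (intro mult_right_mono) auto
    also have "\<dots> = exp (- u) ^ D"
      by (simp add: exp_add[symmetric] exp_of_nat_mult[symmetric])
    finally have "real D * exp (- u\<^sup>2) \<le> exp (- u) ^ D" .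
    moreover have "s n = exp (- u\<^sup>2)" by (simp add: s_eq L)
    moreover have "\<beta> n = exp (- u)" by (simp add: \<beta>_def u_def)
    ultimately show ?case by simp
  qed
  have \<beta>_lim: "\<beta> \<longlonglongrightarrow> 0"
    unfolding \<beta>_def using sqrt_lim
    by (intro filterlim_compose[OF exp_at_bot] filterlim_uminus_at_bot[THEN iffD2]) simp
  have dom_\<beta>: "\<forall>\<^sub>F n in sequentially. real D * \<beta> n \<le> (1/2) ^ D" for D
  proof -
    have "(\<lambda>n. real D * \<beta> n) \<longlonglongrightarrow> 0" using tendsto_mult_right_zero[OF \<beta>_lim] by simp
    then have "\<forall>\<^sub>F n in sequentially. real D * \<beta> n < (1/2) ^ D" by (rule order_tendstoD) simp
    then show ?thesis by (rule eventually_mono) simp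
  qed
  have s_le_\<beta>: "\<forall>\<^sub>F n in sequentially. s n \<le> \<beta> n"
    using dom_s[of 1] by simp
  interpret Y: biased_blocks p U B \<beta>
  proof
    show "\<forall>\<^sub>F n in sequentially. \<forall>i\<in>U n. p i \<le> \<beta> n"
      using s_le_\<beta> by eventually_elim (use p_le_s order_trans in blast)
  qed (use p01 U up in \<open>simp_all add: \<beta>_def\<close>)
  have "Y.sparse {}"
    by (rule Y.sparse_empty[OF _ small dom_\<beta>]) simp
  then obtain Y where Y: "\<And>\<xi>. \<xi> \<in> I \<Longrightarrow> Y \<xi> \<in> F \<xi>" "\<And>E. \<lbrakk>finite E; E \<subseteq> I\<rbrakk> \<Longrightarrow> Y.sparse (\<Union>(Y ` E))"
    using Y.sparse_family[where F = F, OF MA I _ F_nonmeas] by blast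
  obtain B' where up': "\<And>n A A'. \<lbrakk>A \<in> B' n; A \<subseteq> A'; A' \<subseteq> U n\<rbrakk> \<Longrightarrow> A' \<in> B' n"
    and small': "\<forall>\<^sub>F n in sequentially. bexp (\<lambda>_. min 1 (\<beta> n)) (U n) (\<lambda>A. of_bool (A \<in> B' n)) \<le> (1/2) ^ n"
    and cover: "\<And>E. \<lbrakk>finite E; E \<subseteq> I\<rbrakk> \<Longrightarrow> \<forall>\<^sub>F n in sequentially. \<forall>z\<subseteq>U n. (z \<union> \<Union>(Y ` E)) \<inter> U n \<in> B n \<longrightarrow> z \<in> B' n"
    using Y.sparse_family_cover[where X = Y, OF MA I Y(2)] by blast
  interpret Z: biased_blocks p U B' s
    by standard (use p01 U up' p_le_s s_pos in \<open>auto intro: less_imp_le\<close>)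
  have "Z.sparse {}"
  proof (rule Z.sparse_empty[OF _ small'])
    show "\<forall>\<^sub>F n in sequentially. real D * s n \<le> min 1 (\<beta> n) ^ D" for D
      using dom_s[of D] order_tendstoD(2)[OF \<beta>_lim zero_less_one]
      by eventually_elim (simp add: min_def)
  qed (simp add: \<beta>_def)
  then obtain Z where Z: "\<And>\<xi>. \<xi> \<in> I \<Longrightarrow> Z \<xi> \<in> F \<xi>" "\<And>E. \<lbrakk>finite E; E \<subseteq> I\<rbrakk> \<Longrightarrow> Z.sparse (\<Union>(Z ` E))"
    using Z.sparse_family[where F = F, OF MA I _ F_nonmeas] by blast
  have Z_avoids: "\<forall>\<^sub>F n in sequentially. \<Union>(Z ` E) \<inter> U n \<notin> B' n" if E: "finite E" "E \<subseteq> I" for E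
  proof -
    have "\<forall>\<^sub>F n in sequentially. Z.hit n 1 (\<Union>(Z ` E)) \<le> (1/2) ^ (1 * n)"
      using Z(2)[OF E] unfolding Z.sparse_def by blast
    with eventually_ge_at_top[of 1] show ?thesis
    proof eventually_elim
      case (elim n)
      show ?case
      proof
        assume *: "\<Union>(Z ` E) \<inter> U n \<in> B' n"
        \<comment> \<open>By upward closure every enlargement of the trace would be in
          \<open>B' n\<close> too, so \<open>hit\<close> would equal 1.\<close>
        have "1 = bexp (\<lambda>_. min 1 (real 1 * s n)) (U n) (\<lambda>_. 1)" by (rule bexp_const[symmetric]) (rule U)
        also have "\<dots> = Z.hit n 1 (\<Union>(Z ` E))"
          unfolding Z.hit_def using up'[OF *, of "(A \<union> \<Union>(Z ` E)) \<inter> U n" for A]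
          by (intro bexp_cong) auto
        also have "\<dots> \<le> (1/2) ^ n" using elim by simp
        also have "\<dots> < 1" using elim by (intro power_Suc_less_one power_less_one_iff[THEN iffD2]) auto
        finally show False by simp
      qed
    qed
  qed
  define X where "X \<xi> = Y \<xi> \<inter> Z \<xi>" for \<xi>
  define G where "G n E \<longleftrightarrow> (\<forall>z\<subseteq>U n. (z \<union> \<Union>(Y ` E)) \<inter> U n \<in> B n \<longrightarrow> z \<in> B' n) \<and> \<Union>(Z ` E) \<inter> U n \<notin> B' n" for n E
  define Good where "Good n c E \<longleftrightarrow> c \<notin> B n \<and> c \<subseteq> U n \<and> \<Union>(X ` E) \<inter> U n \<subseteq> c" for n c E
  obtain c where c: "\<And>E. \<lbrakk>finite E; E \<subseteq> I\<rbrakk> \<Longrightarrow> \<forall>\<^sub>F n in sequentially. Good n (c n) E"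
  proof (rule martin_axiom_uniformization[OF MA I, of "Collect finite" G Good])
    show "\<forall>\<^sub>F n in sequentially. G n E" if "finite E" "E \<subseteq> I" for E
      unfolding G_def using cover[OF that] Z_avoids[OF that] by (rule eventually_conj)
    show "\<exists>c\<in>Collect finite. Good n c E \<and> Good n c E'" if G: "G n E" "G n E'" for n E E'
    proof (intro bexI conjI)
      let ?c = "(\<Union>(X ` E) \<union> \<Union>(X ` E')) \<inter> U n"
      \<comment> \<open>The part from \<open>E\<close> is bounded by the \<open>Y\<close> sets, the
        part from \<open>E'\<close> by the \<open>Z\<close> sets. Were \<open>?c\<close> in
        \<open>B n\<close>, the cover for \<open>E\<close> would put the trace of the
        \<open>Z\<close> union into \<open>B' n\<close>, against \<open>G n E'\<close>.\<close>
      have "?c \<notin> B n"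
      proof
        assume "?c \<in> B n"
        then have "(\<Union>(Z ` E') \<inter> U n \<union> \<Union>(Y ` E)) \<inter> U n \<in> B n"
          by (rule up) (auto simp: X_def)
        then show False using G by (auto simp: G_def)
      qed
      then show "Good n ?c E" "Good n ?c E'" by (auto simp: Good_def)
      show "?c \<in> Collect finite" using U by simp
    qed
    show "Good n c E" if "Good n c E'" "E \<subseteq> E'" for n c E E'
      using that by (auto simp: Good_def)
    show "countable (Collect (finite :: nat set \<Rightarrow> bool))" by (rule countable_Collect_finite)
  qed blast
  \<comment> \<open>The blocks may overlap, so a point has to be accepted by every block containing
    it; points outside all blocks are kept.\<close>
  define W where "W = {i. \<forall>n. i \<in> U n \<longrightarrow> i \<in> c n}"
  show thesis
  proof (rule that)
    show "\<forall>\<^sub>F n in sequentially. W \<inter> U n \<notin> B n"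
      using c[of "{}", OF finite.emptyI empty_subsetI]
    proof eventually_elim
      case (elim n)
      then show ?case using up[of "W \<inter> U n" n "c n"] by (auto simp: Good_def W_def)
    qed
    fix \<xi> assume \<xi>: "\<xi> \<in> I"
    have F: "is_filter (F \<xi>)" "\<And>A. finite (- A) \<Longrightarrow> A \<in> F \<xi>"
      using F_filt[OF \<xi>] by (auto simp: nonprincipal_filter_def)
    obtain N where N: "\<And>n. n \<ge> N \<Longrightarrow> Good n (c n) {\<xi>}"
      using c[of "{\<xi>}"] \<xi> by (auto simp: eventually_sequentially)
    \<comment> \<open>Removes the finitely many blocks where \<open>c n\<close> need not respect
      \<open>X \<xi>\<close>; a cofinite set belongs to each nonprincipal filter.\<close>
    let ?T = "- (\<Union>n<N. U n)"
    have "Y \<xi> \<inter> Z \<xi> \<inter> ?T \<in> F \<xi>"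
      using F Y(1)[OF \<xi>] Z(1)[OF \<xi>] U by (auto simp: is_filter_def)
    moreover have "Y \<xi> \<inter> Z \<xi> \<inter> ?T \<subseteq> W"
    proof
      fix i assume i: "i \<in> Y \<xi> \<inter> Z \<xi> \<inter> ?T"
      show "i \<in> W"
        unfolding W_def
      proof (intro CollectI allI impI)
        fix n assume n: "i \<in> U n"
        then have "n \<ge> N" using i by (meson ComplD IntD2 UN_I lessThan_iff not_le)
        then show "i \<in> c n" using N[of n] n i by (auto simp: Good_def X_def)
      qed
    qed
    ultimately show "W \<in> F \<xi>" using F(1) unfolding is_filter_def by blast
  qed
qed

section \<open>Measurable filters are null\<close>

lemma bexp_marginal:
  assumes "finite W" "V \<subseteq> W"
  shows "bexp p W (\<lambda>A. g (A \<inter> V)) = bexp p V g"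
proof -
  have "bexp p W (\<lambda>A. g (A \<inter> V)) = bexp p (V \<union> (W - V)) (\<lambda>A. g (A \<inter> V))"
    using assms by (simp add: Un_absorb1)
  also have "\<dots> = bexp p V (\<lambda>A. bexp p (W - V) (\<lambda>B. g ((A \<union> B) \<inter> V)))"
    using assms by (intro bexp_Un) (auto intro: finite_subset)
  also have "\<dots> = bexp p V (\<lambda>A. bexp p (W - V) (\<lambda>B. g A))"
    by (intro bexp_cong arg_cong[where f = g]) auto
  also have "\<dots> = bexp p V g"
    using assms by (simp add: bexp_const)
  finally show ?thesis .
qed

text \<open>Used to convert a union bound over all prefixes of a given length into one expectation,
  at the cost of the number of prefixes.\<close>

lemma bexp_half_sum:
  assumes "finite U"
  shows "(\<Sum>A\<in>Pow U. f A) = 2 ^ card U * bexp (\<lambda>_. 1/2) U f"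
proof -
  have "(1/2::real) ^ card A * (1/2) ^ card (U - A) = (1/2) ^ card U" if "A \<subseteq> U" for A
  proof -
    have "card A + card (U - A) = card U"
      using assms that by (metis Diff_disjoint Un_Diff_cancel card_Un_disjoint finite_Diff finite_subset sup.absorb2)
    then show ?thesis by (simp add: power_add[symmetric])
  qed
  then have "bexp (\<lambda>_. 1/2) U f = (\<Sum>A\<in>Pow U. (1/2) ^ card U * f A)"
    unfolding bexp_def by (intro sum.cong) auto
  also have "\<dots> = (1/2) ^ card U * (\<Sum>A\<in>Pow U. f A)"
    by (rule sum_distrib_left[symmetric])
  finally show ?thesis by (simp add: power_divide)
qed

section \<open>Open subsets of the Cantor space and regularity of the product measures\<close>

definition cantor_open :: "(nat \<Rightarrow> bool) set \<Rightarrow> bool" where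
  "cantor_open S \<longleftrightarrow> (\<forall>x\<in>S. \<exists>l. \<forall>y. (\<forall>i<l. y i = x i) \<longrightarrow> y \<in> S)"

text \<open>The largest subset of \<open>S\<close> that depends only on the coordinates below
  \<open>l\<close>; for open \<open>S\<close> these sets increase to \<open>S\<close>.\<close>

definition level :: "nat \<Rightarrow> (nat \<Rightarrow> bool) set \<Rightarrow> (nat \<Rightarrow> bool) set" where
  "level l S = {x. \<forall>y. (\<forall>i<l. y i = x i) \<longrightarrow> y \<in> S}"

lemma level_subset: "level l S \<subseteq> S"
  by (auto simp: level_def)

lemma level_mono: "l \<le> l' \<Longrightarrow> level l S \<subseteq> level l' S"
  by (auto simp: level_def)

lemma level_cong: "(\<And>i. i < l \<Longrightarrow> y i = x i) \<Longrightarrow> y \<in> level l S \<longleftrightarrow> x \<in> level l S"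
  by (auto simp: level_def)

lemma cantor_open_UN_level: "cantor_open S \<Longrightarrow> S = (\<Union>l. level l S)"
  by (auto simp: level_def cantor_open_def)

lemma level_trace: "x \<in> level l S \<longleftrightarrow> {i \<in> {..<l}. x i} \<in> {A. (\<lambda>i. i \<in> A) \<in> level l S}"
  using level_cong[of l x "\<lambda>i. i \<in> {i \<in> {..<l}. x i}" S] by simp

lemma sets_level [measurable]: "level l S \<in> sets (mu_p p)"
  using sets_mu_p_trace[of "{..<l}" "{A. (\<lambda>i. i \<in> A) \<in> level l S}" p]
  unfolding level_trace[of _ l S, symmetric] by simp

lemma sets_cantor_open: "cantor_open S \<Longrightarrow> S \<in> sets (mu_p p)"
  by (subst cantor_open_UN_level) (auto intro: sets.countable_UN)

lemma cantor_open_UN: "(\<And>i. i \<in> I \<Longrightarrow> cantor_open (S i)) \<Longrightarrow> cantor_open (\<Union>i\<in>I. S i)"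
  unfolding cantor_open_def by (metis UN_iff)

lemma cantor_open_Int:
  assumes "cantor_open S" "cantor_open T"
  shows "cantor_open (S \<inter> T)"
  unfolding cantor_open_def
proof
  fix x assume "x \<in> S \<inter> T"
  then obtain l m where "\<And>y. (\<forall>i<l. y i = x i) \<Longrightarrow> y \<in> S" "\<And>y. (\<forall>i<m. y i = x i) \<Longrightarrow> y \<in> T"
    using assms unfolding cantor_open_def by blast
  then show "\<exists>l. \<forall>y. (\<forall>i<l. y i = x i) \<longrightarrow> y \<in> S \<inter> T"
    by (intro exI[of _ "max l m"]) auto
qed

lemma cantor_open_INT_finite:
  assumes "finite I" "\<And>i. i \<in> I \<Longrightarrow> cantor_open (S i)"
  shows "cantor_open (\<Inter>i\<in>I. S i)"
  using assms
proof (induction I rule: finite_induct)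
  case empty
  then show ?case by (auto simp: cantor_open_def)
qed (auto intro!: cantor_open_Int)

text \<open>Closed sets inside and open sets outside, by induction over the generated sigma-algebra.
  Subbasic sets are both open and closed, and complementation swaps the two approximations.\<close>

lemma mu_p_regular:
  assumes "S \<in> sets (mu_p p)" "0 < e"
  shows "\<exists>T K. cantor_open T \<and> cantor_open (- K) \<and> K \<subseteq> S \<and> S \<subseteq> T \<and> measure (mu_p p) (T - K) < e"
proof -
  interpret prob_space "mu_p p" by (rule prob_space_mu_p)
  have K: "K \<in> events" if "cantor_open (- K)" for K
    using sets.compl_sets[OF sets_cantor_open[OF that, of p]] by (simp add: Diff_eq)
  have "S \<in> sigma_sets UNIV {{f. f i \<in> A} |i A. True}"
    using assms(1) unfolding mu_p_def sets_PiM_single by (simp add: PiE_UNIV_domain)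
  then show ?thesis using assms(2)
  proof (induction arbitrary: e rule: sigma_sets.induct)
    case (Basic S)
    then obtain i A where S: "S = {f. f i \<in> A}" by blast
    have "cantor_open S" "cantor_open (- S)"
      unfolding cantor_open_def S by (auto intro!: exI[of _ "Suc i"])
    then show ?case using Basic(2) by (intro exI[of _ S]) auto
  next
    case Empty
    then show ?case by (intro exI[of _ "{}"]) (auto simp: cantor_open_def)
  next
    case (Compl S)
    then obtain T K where "cantor_open T" "cantor_open (- K)" "K \<subseteq> S" "S \<subseteq> T" "prob (T - K) < e"
      by blast
    moreover have "- K - - T = T - K" by auto
    ultimately show ?case by (intro exI[of _ "- K"] exI[of _ "- T"]) auto
  next
    case (Union S)
    \<comment> \<open>The errors add up to \<open>e / 2\<close>. The other half pays for keeping
      only finitely many of the sets \<open>K i\<close>, so that the inner set stays closed.\<close>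
    have "\<exists>T K. cantor_open T \<and> cantor_open (- K) \<and> K \<subseteq> S i \<and> S i \<subseteq> T \<and> prob (T - K) < (e / 2) * (1/2) ^ Suc i" for i
      using Union.prems by (intro Union.IH) auto
    then obtain T K where TK: "\<And>i. cantor_open (T i)" "\<And>i. cantor_open (- K i)" "\<And>i. K i \<subseteq> S i" "\<And>i. S i \<subseteq> T i"
      and small: "\<And>i. prob (T i - K i) < (e / 2) * (1/2) ^ Suc i"
      by metis
    have ev: "T i \<in> events" "K i \<in> events" for i
      using TK sets_cantor_open K by auto
    let ?T = "\<Union>i. T i" and ?K = "\<lambda>m. \<Union>i<m. K i"
    have ss: "(\<lambda>i. (e / 2) * (1/2::real) ^ Suc i) sums ((e / 2) * 1)"
      by (intro sums_mult power_half_series)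
    have "prob (\<Union>i. T i - K i) \<le> (\<Sum>i. prob (T i - K i))"
    proof (rule finite_measure_subadditive_countably)
      show "summable (\<lambda>i. prob (T i - K i))"
        by (rule summable_comparison_test'[OF sums_summable[OF ss], of 0]) (use small less_imp_le in auto)
    qed (use ev in auto)
    also have "\<dots> \<le> (\<Sum>i. (e / 2) * (1/2::real) ^ Suc i)"
    proof (rule suminf_le)
      show "summable (\<lambda>i. prob (T i - K i))"
        by (rule summable_comparison_test'[OF sums_summable[OF ss], of 0]) (use small less_imp_le in auto)
    qed (use small less_imp_le sums_summable[OF ss] in auto)
    also have "\<dots> = e / 2" using sums_unique[OF ss] by simp
    finally have 1: "prob (\<Union>i. T i - K i) \<le> e / 2" .
    have "(\<lambda>m. prob (?K m)) \<longlonglongrightarrow> prob (\<Union>m. ?K m)"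
      using ev by (intro finite_Lim_measure_incseq) (auto simp: incseq_def intro: order_less_le_trans)
    then have "\<forall>\<^sub>F m in sequentially. prob (\<Union>m. ?K m) - e / 2 < prob (?K m)"
      using Union.prems by (intro order_tendstoD(1)) auto
    then obtain m where m: "prob (\<Union>m. ?K m) - e / 2 < prob (?K m)"
      by (auto simp: eventually_sequentially)
    have "?T - ?K m \<subseteq> (\<Union>i. T i - K i) \<union> ((\<Union>m. ?K m) - ?K m)" by auto
    then have "prob (?T - ?K m) \<le> prob ((\<Union>i. T i - K i) \<union> ((\<Union>m. ?K m) - ?K m))"
      using ev by (intro finite_measure_mono) auto
    also have "\<dots> \<le> prob (\<Union>i. T i - K i) + prob ((\<Union>m. ?K m) - ?K m)"
      using ev by (intro measure_Un_le) auto
    also have "prob ((\<Union>m. ?K m) - ?K m) = prob (\<Union>m. ?K m) - prob (?K m)"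
      using ev by (intro finite_measure_Diff) auto
    finally have "prob (?T - ?K m) < e" using 1 m by linarith
    moreover have "cantor_open (- ?K m)"
      using cantor_open_INT_finite[of "{..<m}" "\<lambda>i. - K i"] TK(2) by simp
    moreover have "cantor_open ?T" using TK(1) by (intro cantor_open_UN)
    moreover have "?K m \<subseteq> (\<Union>i. S i)" "(\<Union>i. S i) \<subseteq> ?T" using TK(3,4) by blast+
    ultimately show ?case by blast
  qed
qed

text \<open>A fair coin is invariant under negation, so the flipped measure agrees with the product
  measure on finite rectangles and hence everywhere.\<close>

lemma mu_half_flip:
  assumes "S \<in> sets (mu_p (\<lambda>_. 1/2))"
  shows "{x. (\<lambda>i. if i < l then x i else \<not> x i) \<in> S} \<in> sets (mu_p (\<lambda>_. 1/2))"
    and "measure (mu_p (\<lambda>_. 1/2)) {x. (\<lambda>i. if i < l then x i else \<not> x i) \<in> S} = measure (mu_p (\<lambda>_. 1/2)) S"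
proof -
  let ?b = "measure_pmf (bernoulli_pmf (1/2))"
  let ?M = "PiM UNIV (\<lambda>_::nat. ?b)"
  define f where "f x i = (if i < l then x i else \<not> x i)" for x i
  interpret P: product_prob_space "\<lambda>_::nat. ?b" UNIV by unfold_locales
  have f: "f \<in> measurable ?M ?M"
  proof (rule measurable_PiM_single')
    fix i :: nat
    have c: "(\<lambda>x. x i) \<in> measurable ?M ?b" by simp
    have "Not \<in> measurable ?b ?b" by simp
    from measurable_compose[OF c this] have "(\<lambda>x. \<not> x i) \<in> measurable ?M ?b" .
    with c show "(\<lambda>x. f x i) \<in> measurable ?M ?b" by (simp add: f_def)
  qed auto
  have flip: "map_pmf Not (bernoulli_pmf (1/2)) = bernoulli_pmf (1/2)"
  proof (rule pmf_eqI)
    fix b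
    have "pmf (map_pmf Not (bernoulli_pmf (1/2))) (\<not> \<not> b) = pmf (bernoulli_pmf (1/2)) (\<not> b)"
      by (rule pmf_map_inj') (auto simp: inj_def)
    then show "pmf (map_pmf Not (bernoulli_pmf (1/2))) b = pmf (bernoulli_pmf (1/2)) b"
      by (cases b) simp_all
  qed
  have "distr ?M ?M f = ?M"
  proof (rule P.PiM_eq)
    fix J :: "nat set" and A :: "nat \<Rightarrow> bool set"
    assume J: "finite J" "J \<subseteq> UNIV"
    define A' where "A' i = (if i < l then A i else Not -` A i)" for i
    have eq: "emeasure ?b (A' i) = emeasure ?b (A i)" for i
    proof -
      have "emeasure ?b (Not -` A i) = emeasure (measure_pmf (map_pmf Not (bernoulli_pmf (1/2)))) (A i)"
        by simp
      then show ?thesis by (simp add: A'_def flip)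
    qed
    have f_A: "f x i \<in> A i \<longleftrightarrow> x i \<in> A' i" for x i by (simp add: f_def A'_def)
    have "emeasure (distr ?M ?M f) (prod_emb UNIV (\<lambda>_. ?b) J (PiE J A)) =
        emeasure ?M (f -` prod_emb UNIV (\<lambda>_. ?b) J (PiE J A) \<inter> space ?M)"
      using J by (intro emeasure_distr f sets_PiM_I) auto
    also have "f -` prod_emb UNIV (\<lambda>_. ?b) J (PiE J A) \<inter> space ?M = prod_emb UNIV (\<lambda>_. ?b) J (PiE J A')"
      by (auto simp: prod_emb_def space_PiM PiE_iff f_A)
    also have "emeasure ?M \<dots> = (\<Prod>j\<in>J. emeasure ?b (A' j))"
      using J by (intro P.emeasure_PiM_emb) auto
    finally show "emeasure (distr ?M ?M f) (prod_emb UNIV (\<lambda>_. ?b) J (PiE J A)) = (\<Prod>j\<in>J. emeasure ?b (A j))"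
      by (simp add: eq)
  qed simp
  moreover have "{x. f x \<in> S} = f -` S \<inter> space ?M"
    by (auto simp: space_PiM)
  ultimately have "{x. f x \<in> S} \<in> sets (mu_p (\<lambda>_. 1/2))"
    "measure (mu_p (\<lambda>_. 1/2)) {x. f x \<in> S} = measure (mu_p (\<lambda>_. 1/2)) S"
    using measurable_sets[OF f] measure_distr[OF f, of S] assms by (simp_all add: mu_p_def)
  then show "{x. (\<lambda>i. if i < l then x i else \<not> x i) \<in> S} \<in> sets (mu_p (\<lambda>_. 1/2))"
    and "measure (mu_p (\<lambda>_. 1/2)) {x. (\<lambda>i. if i < l then x i else \<not> x i) \<in> S} = measure (mu_p (\<lambda>_. 1/2)) S"
    by (simp_all add: f_def[abs_def])
qed

text \<open>If a measurable part \<open>S\<close> of a filter had positive measure, then flipping all coordinates beyond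
  some \<open>l\<close> would map a point of \<open>S\<close> into \<open>S\<close>; the two sets meet in a finite set only.\<close>

lemma measurable_filter_null:
  assumes G: "nonprincipal_filter G" and meas: "measurable_wrt lebesgue_cantor G"
  obtains N where "N \<in> null_sets lebesgue_cantor" "char_set G \<subseteq> N"
proof -
  let ?M = "mu_p (\<lambda>_. 1/2)"
  interpret prob_space ?M by (rule prob_space_mu_p)
  have C: "char_set G \<in> sets (completion ?M)"
    using meas by (simp add: measurable_wrt_def lebesgue_cantor_def)
  \<comment> \<open>A set in the completion is a set of the original sigma-algebra together with a
    subset of a null set.\<close>
  define S where "S = main_part ?M (char_set G)"
  have GS: "char_set G = S \<union> null_part ?M (char_set G)"
    using main_part_null_part_Un[OF C] by (simp add: S_def)
  have S: "S \<in> events" "S \<subseteq> char_set G"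
    using C by (simp add: S_def) (use GS in blast)
  have "prob S = 0"
  proof (rule ccontr)
    assume "prob S \<noteq> 0"
    \<comment> \<open>The margin of a third gives \<open>prob T < 4/3 * prob S\<close> and
      \<open>prob R > 2/3 * prob S\<close>, while \<open>T\<close> contains \<open>R\<close> and its
      disjoint flip, both of the same measure.\<close>
    then have pos: "0 < prob S / 3" by (simp add: zero_less_measure_iff)
    obtain T K where T: "cantor_open T" "K \<subseteq> S" "S \<subseteq> T" "cantor_open (- K)" "prob (T - K) < prob S / 3"
      using mu_p_regular[OF S(1) pos] by blast
    have Tm: "T \<in> events" using sets_cantor_open T(1) by blast
    have K: "K \<in> events"
      using sets.compl_sets[OF sets_cantor_open[OF T(4), of "\<lambda>_. 1/2"]] by (simp add: Diff_eq)
    have "prob (T - S) \<le> prob (T - K)" using T Tm K S by (intro finite_measure_mono) auto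
    then have TS: "prob T - prob S < prob S / 3"
      using T finite_measure_Diff[OF Tm S(1) T(3)] by linarith
    have "(\<lambda>l. prob (level l T)) \<longlonglongrightarrow> prob (\<Union>l. level l T)"
      using level_mono by (intro finite_Lim_measure_incseq) (auto simp: incseq_def)
    then have "(\<lambda>l. prob (level l T)) \<longlonglongrightarrow> prob T"
      using cantor_open_UN_level[OF T(1)] by simp
    then have "\<forall>\<^sub>F l in sequentially. prob T - prob S / 3 < prob (level l T)"
      using pos by (intro order_tendstoD(1)) auto
    then obtain l where l: "prob T - prob S / 3 < prob (level l T)"
      by (auto simp: eventually_sequentially)
    define f where "f x i = (if i < l then x i else \<not> x i)" for x i
    define R where "R = S \<inter> level l T"
    have R: "R \<in> events" using S by (simp add: R_def)
    have fR: "{x. f x \<in> R} \<in> events" "prob {x. f x \<in> R} = prob R"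
      using mu_half_flip[OF R, of l] by (simp_all add: f_def[abs_def])
    have "R \<inter> {x. f x \<in> R} = {}"
    proof -
      have False if "x \<in> S" "f x \<in> S" for x
      proof -
        have "{n. x n} \<in> G" "{n. f x n} \<in> G" using S(2) that by (auto simp: char_set_def)
        moreover have "{l..} \<in> G"
        proof -
          have "finite (- {l..})" by (rule finite_subset[of _ "{..<l}"]) auto
          then show ?thesis using G by (simp add: nonprincipal_filter_def)
        qed
        ultimately have "{n. x n} \<inter> {n. f x n} \<inter> {l..} \<in> G"
          using G by (simp add: nonprincipal_filter_def is_filter_def)
        moreover have "{n. x n} \<inter> {n. f x n} \<inter> {l..} = {}" by (auto simp: f_def)
        ultimately show False using G by (simp add: nonprincipal_filter_def is_filter_def)
      qed
      then show ?thesis by (auto simp: R_def)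
    qed
    then have "2 * prob R = prob (R \<union> {x. f x \<in> R})"
      using finite_measure_Union[OF R fR(1)] fR(2) by simp
    also have "\<dots> \<le> prob T"
    proof (rule finite_measure_mono[OF _ Tm])
      \<comment> \<open>\<open>level l T\<close> ignores the coordinates that are flipped, so the
        flip of \<open>R\<close> stays inside \<open>T\<close>.\<close>
      have "x \<in> level l T" if "f x \<in> level l T" for x
        using that level_cong[of l "f x" x T] by (simp add: f_def)
      then show "R \<union> {x. f x \<in> R} \<subseteq> T" using level_subset[of l T] by (auto simp: R_def)
    qed
    finally have 1: "2 * prob R \<le> prob T" .
    have "S \<subseteq> R \<union> (T - level l T)" using T by (auto simp: R_def)
    then have "prob S \<le> prob (R \<union> (T - level l T))" using R Tm by (intro finite_measure_mono) auto
    also have "\<dots> \<le> prob R + prob (T - level l T)" using R Tm by (intro measure_Un_le) auto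
    also have "prob (T - level l T) = prob T - prob (level l T)"
      using Tm level_subset by (intro finite_measure_Diff) auto
    finally show False using 1 l TS by linarith
  qed
  then have "S \<in> null_sets ?M" using S by (auto simp: null_sets_def emeasure_eq_measure)
  moreover obtain N where "N \<in> null_sets ?M" "null_part ?M (char_set G) \<subseteq> N"
    using null_part[OF C] by blast
  ultimately show thesis
    using that[of "S \<union> N"] GS by (auto simp: lebesgue_cantor_def null_sets.Un)
qed

section \<open>Null filters and finite blocks\<close>

lemma of_bool_Bex_le_sum:
  assumes "finite S"
  shows "of_bool (\<exists>x\<in>S. P x) \<le> (\<Sum>x\<in>S. of_bool (P x) :: real)"
proof (cases "\<exists>x\<in>S. P x")
  case True
  then obtain x where x: "x \<in> S" "P x" by blast
  have "(of_bool (P x) :: real) \<le> (\<Sum>x\<in>S. of_bool (P x))"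
    using assms x(1) by (intro member_le_sum) auto
  then show ?thesis using x by auto
qed (simp add: sum_nonneg)

text \<open>Cover \<open>N\<close> by open sets \<open>T i\<close> of measure at most
  \<open>(1/2) ^ i\<close>. A point of \<open>N\<close> enters \<open>T i\<close> at some finite
  level; \<open>D l\<close> collects the entries at level \<open>l\<close>, and for each
  \<open>i\<close> the measures telescope to at most that of \<open>T i\<close>.\<close>

lemma null_set_levels:
  assumes N: "N \<in> null_sets (mu_p p)" and p: "\<And>n. 0 \<le> p n \<and> p n \<le> 1"
  obtains D where "\<And>n. (\<Sum>l<n. bexp p {..<l} (\<lambda>A. of_bool (A \<in> D l))) \<le> 2"
    "\<And>x. x \<in> N \<Longrightarrow> \<exists>\<^sub>F l in sequentially. {i \<in> {..<l}. x i} \<in> D l"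
proof -
  interpret prob_space "mu_p p" by (rule prob_space_mu_p)
  have "\<exists>T. cantor_open T \<and> N \<subseteq> T \<and> prob T \<le> (1/2) ^ i" for i :: nat
  proof -
    obtain T K where T: "cantor_open T" "K \<subseteq> N" "N \<subseteq> T" "cantor_open (- K)" "prob (T - K) < (1/2) ^ i"
      using mu_p_regular[of N p "(1/2) ^ i"] N by auto
    have ev: "T \<in> events" "K \<in> events" "N \<in> events"
      using sets_cantor_open[OF T(1)] sets.compl_sets[OF sets_cantor_open[OF T(4), of p]] N
      by (auto simp: Diff_eq)
    have "prob T \<le> prob ((T - K) \<union> N)" using ev T by (intro finite_measure_mono) auto
    also have "\<dots> \<le> prob (T - K) + prob N" using ev by (intro measure_Un_le) auto
    also have "prob N = 0" using N by (simp add: measure_eq_0_null_sets)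
    finally show ?thesis using T by (intro exI[of _ T]) auto
  qed
  then obtain T where T: "\<And>i. cantor_open (T i)" "\<And>i. N \<subseteq> T i" "\<And>i. prob (T i) \<le> (1/2) ^ i"
    by metis
  \<comment> \<open>Entry into \<open>T i\<close> at level \<open>l\<close>. Earlier entries are all
    counted at \<open>l = i\<close>, which ensures that every point of \<open>N\<close> produces
    events at arbitrarily high levels.\<close>
  define S where "S i l = level l (T i) - (if i < l then level (l - 1) (T i) else {})" for i l
  define D where "D l = {A. \<exists>i\<in>{..l}. (\<lambda>j. j \<in> A) \<in> S i l}" for l
  have S_ev: "S i l \<in> events" for i l by (simp add: S_def)
  have S_cong: "(\<lambda>j. j \<in> {i \<in> {..<l}. x i}) \<in> S i l \<longleftrightarrow> x \<in> S i l" for x i l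
  proof -
    have "(\<lambda>j. j \<in> {i \<in> {..<l}. x i}) \<in> level l (T i) \<longleftrightarrow> x \<in> level l (T i)"
      "(\<lambda>j. j \<in> {i \<in> {..<l}. x i}) \<in> level (l - 1) (T i) \<longleftrightarrow> x \<in> level (l - 1) (T i)"
      by (rule level_cong; auto)+
    then show ?thesis by (simp add: S_def)
  qed
  have D_eq: "{x. {i \<in> {..<l}. x i} \<in> D l} = (\<Union>i\<le>l. S i l)" for l
    using S_cong by (auto simp: D_def)
  have D_le: "bexp p {..<l} (\<lambda>A. of_bool (A \<in> D l)) \<le> (\<Sum>i\<le>l. prob (S i l))" for l
  proof -
    have "bexp p {..<l} (\<lambda>A. of_bool (A \<in> D l)) = prob {x. {i \<in> {..<l}. x i} \<in> D l}"
      using p by (intro measure_mu_p_trace[symmetric]) auto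
    also have "\<dots> \<le> (\<Sum>i\<le>l. prob (S i l))"
      unfolding D_eq using S_ev by (intro finite_measure_subadditive_finite) auto
    finally show ?thesis .
  qed
  have S_sum: "(\<Sum>l<n. \<Sum>i\<le>l. prob (S i l)) = (\<Sum>i<n. prob (level (n - 1) (T i)))" for n
  proof (induction n)
    case (Suc n)
    have "(\<Sum>i<n. prob (level n (T i))) = (\<Sum>i<n. prob (level (n - 1) (T i)) + prob (S i n))"
    proof (rule sum.cong[OF refl])
      fix i assume "i \<in> {..<n}"
      then have "prob (S i n) = prob (level n (T i)) - prob (level (n - 1) (T i))"
        unfolding S_def using level_mono[of "n - 1" n "T i"] by (simp add: finite_measure_Diff)
      then show "prob (level n (T i)) = prob (level (n - 1) (T i)) + prob (S i n)" by simp
    qed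
    moreover have "prob (S n n) = prob (level n (T n))" by (simp add: S_def)
    ultimately show ?case using Suc by (simp add: sum.distrib lessThan_Suc_atMost[symmetric])
  qed simp
  have level_sum: "(\<Sum>i<n. prob (level (n - 1) (T i))) \<le> 2" for n
  proof -
    have "(\<Sum>i<n. prob (level (n - 1) (T i))) \<le> (\<Sum>i<n. (1/2) ^ i)"
    proof (rule sum_mono)
      fix i
      have "prob (level (n - 1) (T i)) \<le> prob (T i)"
        using T(1) by (intro finite_measure_mono level_subset sets_cantor_open)
      then show "prob (level (n - 1) (T i)) \<le> (1/2) ^ i" using T(3)[of i] by linarith
    qed
    also have "\<dots> \<le> 2" by (simp add: sum_gp_strict)
    finally show ?thesis .
  qed
  have "(\<Sum>l<n. bexp p {..<l} (\<lambda>A. of_bool (A \<in> D l))) \<le> 2" for n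
  proof -
    have "(\<Sum>l<n. bexp p {..<l} (\<lambda>A. of_bool (A \<in> D l))) \<le> (\<Sum>l<n. \<Sum>i\<le>l. prob (S i l))"
      by (intro sum_mono D_le)
    then show ?thesis using S_sum[of n] level_sum[of n] by linarith
  qed
  moreover have "\<exists>\<^sub>F l in sequentially. {i \<in> {..<l}. x i} \<in> D l" if "x \<in> N" for x
    unfolding frequently_sequentially
  proof
    fix m
    have "x \<in> (\<Union>l. level l (T m))" using that T(2)[of m] cantor_open_UN_level[OF T(1)[of m]] by blast
    then obtain l0 where "x \<in> level l0 (T m)" by blast
    then have ex: "x \<in> level (max m l0) (T m)" using level_mono[of l0 "max m l0"] by auto
    define l where "l = (LEAST l. m \<le> l \<and> x \<in> level l (T m))"
    have l: "m \<le> l \<and> x \<in> level l (T m)"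
      unfolding l_def by (rule LeastI[of _ "max m l0"]) (use ex in simp)
    have "x \<notin> level (l - 1) (T m)" if "m < l"
      using not_less_Least[of "l - 1" "\<lambda>l. m \<le> l \<and> x \<in> level l (T m)"] that unfolding l_def[symmetric] by auto
    then have "x \<in> S m l" using l by (auto simp: S_def)
    then show "\<exists>n\<ge>m. {i \<in> {..<n}. x i} \<in> D n" using l D_eq[of l] by blast
  qed
  ultimately show thesis using that by blast
qed

lemma strict_mono_bracket:
  fixes a :: "nat \<Rightarrow> nat"
  assumes "strict_mono a" "a m \<le> l"
  obtains k where "m \<le> k" "a k \<le> l" "l < a (Suc k)"
proof -
  define S where "S = {k. a k \<le> l}"
  have fin: "finite S"
  proof (rule finite_subset)
    show "S \<subseteq> {..l}"
      unfolding S_def using strict_mono_imp_increasing[OF assms(1)] order_trans by blast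
  qed simp
  have ne: "m \<in> S" using assms by (simp add: S_def)
  have "Max S \<in> S" using Max_in fin ne by blast
  moreover have "Suc (Max S) \<notin> S" using Max_ge[OF fin, of "Suc (Max S)"] by auto
  moreover have "m \<le> Max S" using fin ne by (rule Max_ge)
  ultimately show thesis using that by (auto simp: S_def)
qed

text \<open>An event at a level between \<open>a (Suc k)\<close> and \<open>a (k + 2)\<close> is
  made independent of the coordinates below \<open>a k\<close> by allowing every prefix. This costs
  a factor \<open>2 ^ a k\<close>, which the fast growth of \<open>a\<close> absorbs into the tail
  of the series.\<close>

lemma null_set_windows:
  assumes N: "N \<in> null_sets (mu_p (\<lambda>_. 1/2))"
  obtains a :: "nat \<Rightarrow> nat" and E where "strict_mono a"
    "\<And>k. bexp (\<lambda>_. 1/2) {a k..<a (k + 2)} (\<lambda>A. of_bool (A \<in> E k)) \<le> (1/16) ^ k"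
    "\<And>x. x \<in> N \<Longrightarrow> \<exists>\<^sub>F k in sequentially. {i \<in> {a k..<a (k + 2)}. x i} \<in> E k"
proof -
  let ?h = "\<lambda>_::nat. 1/2 :: real"
  obtain D where D: "\<And>n. (\<Sum>l<n. bexp ?h {..<l} (\<lambda>A. of_bool (A \<in> D l))) \<le> 2"
    "\<And>x. x \<in> N \<Longrightarrow> \<exists>\<^sub>F l in sequentially. {i \<in> {..<l}. x i} \<in> D l"
    by (rule null_set_levels[OF N]) auto
  define d where "d l = bexp ?h {..<l} (\<lambda>A. of_bool (A \<in> D l))" for l
  have d_nonneg: "0 \<le> d l" for l unfolding d_def by (intro bexp_nonneg) auto
  have "summable d"
    using D(1) d_nonneg by (intro bounded_imp_summable[of d 2]) (auto simp: d_def lessThan_Suc_atMost[symmetric] simp del: sum.lessThan_Suc)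
  then have "\<exists>n>b. \<forall>m. sum d {n..<m} \<le> (1/2) ^ b * (1/16) ^ k" for b k
  proof -
    obtain n where n: "\<And>m n'. n \<le> m \<Longrightarrow> norm (sum d {m..<n'}) < (1/2) ^ b * (1/16) ^ k"
      using \<open>summable d\<close> unfolding summable_Cauchy by (metis mult_pos_pos zero_less_power zero_less_divide_iff zero_less_numeral zero_less_one)
    show ?thesis
      using n[of "max n (Suc b)"] less_imp_le by (intro exI[of _ "max n (Suc b)"]) (fastforce simp: abs_le_iff)
  qed
  then obtain nxt where nxt: "\<And>b k. b < nxt b k" "\<And>b k m. sum d {nxt b k..<m} \<le> (1/2) ^ b * (1/16) ^ k"
    by metis
  define a where "a = rec_nat 0 (\<lambda>k b. nxt b k)"
  have a_Suc: "a (Suc k) = nxt (a k) k" for k by (simp add: a_def)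
  have a: "strict_mono a" by (rule strict_monoI_Suc) (simp add: a_Suc nxt(1))
  have tail: "sum d {a (Suc k)..<m} \<le> (1/2) ^ a k * (1/16) ^ k" for k m
    unfolding a_Suc by (rule nxt)
  define V where "V k = {a k..<a (k + 2)}" for k
  \<comment> \<open>A pair \<open>q\<close> consists of a level and a prefix that completes the
    window trace \<open>z\<close> to an element of \<open>D\<close>.\<close>
  define E where "E k = {z. \<exists>q\<in>{a (Suc k)..<a (k + 2)} \<times> Pow {..<a k}. (snd q \<union> z) \<inter> {..<fst q} \<in> D (fst q)}" for k
  have a_less: "a k < a (Suc k)" "a (Suc k) < a (k + 2)" for k
    using a by (auto simp: strict_mono_Suc_iff)
  have "bexp ?h (V k) (\<lambda>A. of_bool (A \<in> E k)) \<le> (1/16) ^ k" for k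
  proof -
    let ?L = "{a (Suc k)..<a (k + 2)}" and ?f = "\<lambda>l A. of_bool (A \<inter> {..<l} \<in> D l) :: real"
    have "bexp ?h (V k) (\<lambda>z. of_bool (z \<in> E k)) \<le>
        bexp ?h (V k) (\<lambda>z. \<Sum>q\<in>?L \<times> Pow {..<a k}. ?f (fst q) (snd q \<union> z))"
      unfolding E_def mem_Collect_eq by (intro bexp_mono of_bool_Bex_le_sum) auto
    also have "\<dots> = (\<Sum>q\<in>?L \<times> Pow {..<a k}. bexp ?h (V k) (\<lambda>z. ?f (fst q) (snd q \<union> z)))"
      by (rule bexp_sum)
    also have "\<dots> = (\<Sum>l\<in>?L. \<Sum>s\<in>Pow {..<a k}. bexp ?h (V k) (\<lambda>z. ?f l (s \<union> z)))"
      by (simp add: sum.cartesian_product split_def)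
    also have "\<dots> = (\<Sum>l\<in>?L. 2 ^ a k * d l)"
    proof (rule sum.cong[OF refl])
      fix l assume l: "l \<in> ?L"
      have "(\<Sum>s\<in>Pow {..<a k}. bexp ?h (V k) (\<lambda>z. ?f l (s \<union> z))) =
          2 ^ a k * bexp ?h {..<a k} (\<lambda>s. bexp ?h (V k) (\<lambda>z. ?f l (s \<union> z)))"
        by (simp add: bexp_half_sum)
      also have "bexp ?h {..<a k} (\<lambda>s. bexp ?h (V k) (\<lambda>z. ?f l (s \<union> z))) = bexp ?h ({..<a k} \<union> V k) (?f l)"
        by (rule bexp_Un[symmetric]) (auto simp: V_def)
      also have "\<dots> = bexp ?h {..<l} (\<lambda>A. of_bool (A \<in> D l))"
        by (rule bexp_marginal) (use l a_less[of k] in \<open>auto simp: V_def\<close>)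
      finally show "(\<Sum>s\<in>Pow {..<a k}. bexp ?h (V k) (\<lambda>z. ?f l (s \<union> z))) = 2 ^ a k * d l"
        by (simp add: d_def)
    qed
    also have "\<dots> = 2 ^ a k * sum d ?L" by (simp add: sum_distrib_left)
    also have "\<dots> \<le> 2 ^ a k * ((1/2) ^ a k * (1/16) ^ k)"
      by (intro mult_left_mono tail) simp
    also have "\<dots> = (1/16) ^ k" by (simp add: power_divide)
    finally show ?thesis .
  qed
  moreover have "\<exists>\<^sub>F k in sequentially. {i \<in> V k. x i} \<in> E k" if x: "x \<in> N" for x
    unfolding frequently_sequentially
  proof
    fix m
    \<comment> \<open>Starting from \<open>a (Suc m)\<close> ensures that the interval containing
      \<open>l\<close> has a predecessor, which opens the window.\<close>
    obtain l where l: "a (Suc m) \<le> l" "{i \<in> {..<l}. x i} \<in> D l"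
      using D(2)[OF x] unfolding frequently_sequentially by blast
    obtain k' where k': "Suc m \<le> k'" "a k' \<le> l" "l < a (Suc k')"
      using strict_mono_bracket[OF a l(1)] by blast
    then obtain k where k: "k' = Suc k" "m \<le> k" by (cases k') auto
    have "({i \<in> {..<a k}. x i} \<union> {i \<in> V k. x i}) \<inter> {..<l} = {i \<in> {..<l}. x i}"
      using k k' by (auto simp: V_def)
    then have "{i \<in> V k. x i} \<in> E k"
      unfolding E_def using k k' l(2) by (intro CollectI bexI[of _ "(l, {i \<in> {..<a k}. x i})"]) auto
    then show "\<exists>n\<ge>m. {i \<in> V n. x i} \<in> E n" using k by blast
  qed
  ultimately show thesis using that[of a E] a by (simp add: V_def)
qed

text \<open>The largest family of subsets of \<open>U\<close> that is contained in \<open>B\<close>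
  and upward closed within \<open>U\<close>.\<close>

definition up_core :: "nat set \<Rightarrow> nat set set \<Rightarrow> nat set set" where
  "up_core U B = {z. z \<subseteq> U \<and> (\<forall>t. z \<subseteq> t \<longrightarrow> t \<subseteq> U \<longrightarrow> t \<in> B)}"

text \<open>A trace outside the core can be enlarged within its block to leave \<open>B\<close>. As
  the blocks are disjoint, all these enlargements can be added to \<open>X\<close> at once, and the
  result is still in \<open>G\<close>.\<close>

lemma up_core_dichotomy:
  assumes G: "\<And>A A'. \<lbrakk>A \<in> G; A \<subseteq> A'\<rbrakk> \<Longrightarrow> A' \<in> G"
    and disj: "\<And>m n. m \<noteq> n \<Longrightarrow> U m \<inter> U n = {}"
  shows "(\<forall>X\<in>G. \<exists>\<^sub>F n in sequentially. X \<inter> U n \<in> up_core (U n) (B n)) \<or>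
    (\<exists>Y\<in>G. \<forall>\<^sub>F n in sequentially. Y \<inter> U n \<notin> B n)"
proof (cases "\<forall>X\<in>G. \<exists>\<^sub>F n in sequentially. X \<inter> U n \<in> up_core (U n) (B n)")
  case False
  then obtain X where X: "X \<in> G" "\<forall>\<^sub>F n in sequentially. X \<inter> U n \<notin> up_core (U n) (B n)"
    by (auto simp: not_frequently)
  have "\<exists>t. X \<inter> U n \<subseteq> t \<and> t \<subseteq> U n \<and> (X \<inter> U n \<notin> up_core (U n) (B n) \<longrightarrow> t \<notin> B n)" for n
    by (cases "X \<inter> U n \<in> up_core (U n) (B n)") (auto simp: up_core_def)
  then obtain t where t: "\<And>n. X \<inter> U n \<subseteq> t n" "\<And>n. t n \<subseteq> U n"
    "\<And>n. X \<inter> U n \<notin> up_core (U n) (B n) \<Longrightarrow> t n \<notin> B n"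
    by metis
  let ?Y = "X \<union> (\<Union>n. t n)"
  have "?Y \<inter> U n = t n" for n
  proof -
    have "t m \<inter> U n \<subseteq> t n" for m using disj[of m n] t(2)[of m] by (cases "m = n") auto
    then show ?thesis using t(1)[of n] t(2)[of n] by blast
  qed
  then have "\<forall>\<^sub>F n in sequentially. ?Y \<inter> U n \<notin> B n"
    using X(2) t(3) by (auto elim: eventually_mono)
  moreover have "?Y \<in> G" by (rule G[OF X(1)]) auto
  ultimately show ?thesis by blast
qed simp

lemma up_core_upward: "\<lbrakk>A \<in> up_core U B; A \<subseteq> A'; A' \<subseteq> U\<rbrakk> \<Longrightarrow> A' \<in> up_core U B"
  by (auto simp: up_core_def)

lemma bexp_up_core_le: "bexp (\<lambda>_. 1/2) U (\<lambda>A. of_bool (A \<in> up_core U B)) \<le> bexp (\<lambda>_. 1/2) U (\<lambda>A. of_bool (A \<in> B))"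
  by (intro bexp_mono) (auto simp: up_core_def)

text \<open>The window \<open>k\<close> of a null set overlaps the windows \<open>k - 1\<close> and \<open>k + 1\<close>. Suppose that some \<open>Y \<in> G\<close>
  is good on the blocks \<open>W j\<close>, which leave every third interval free. For \<open>X \<in> G\<close>, the set that agrees
  with \<open>X\<close> on the free intervals and with \<open>Y\<close> elsewhere contains \<open>X \<inter> Y\<close>, so it is in \<open>G\<close>, and only the
  free intervals can put it into the null set.\<close>

lemma null_filter_blocks:
  assumes G: "is_filter G" and N: "N \<in> null_sets lebesgue_cantor" "char_set G \<subseteq> N"
  obtains U B where "\<And>n. finite (U n)" "\<And>m. \<forall>\<^sub>F n in sequentially. \<forall>i\<in>U n. m \<le> i"
    "\<And>n A A'. \<lbrakk>A \<in> B n; A \<subseteq> A'; A' \<subseteq> U n\<rbrakk> \<Longrightarrow> A' \<in> B n"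
    "\<forall>\<^sub>F n in sequentially. bexp (\<lambda>_. 1/2) (U n) (\<lambda>A. of_bool (A \<in> B n)) \<le> (1/2) ^ n"
    "\<And>X. X \<in> G \<Longrightarrow> \<exists>\<^sub>F n in sequentially. X \<inter> U n \<in> B n"
proof -
  let ?h = "\<lambda>_::nat. 1/2 :: real"
  obtain a :: "nat \<Rightarrow> nat" and E where a: "strict_mono a"
    and small: "\<And>k. bexp ?h {a k..<a (k + 2)} (\<lambda>A. of_bool (A \<in> E k)) \<le> (1/16) ^ k"
    and inf: "\<And>x. x \<in> N \<Longrightarrow> \<exists>\<^sub>F k in sequentially. {i \<in> {a k..<a (k + 2)}. x i} \<in> E k"
    by (rule null_set_windows[OF N(1)[unfolded lebesgue_cantor_def]]) blast
  define I where "I k = {a k..<a (Suc k)}" for k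
  have I_fin [simp]: "finite (I k)" for k by (simp add: I_def)
  have a_le: "a k \<le> a m" if "k \<le> m" for k m using a that by (simp add: strict_mono_less_eq)
  have V: "{a k..<a (k + 2)} = I k \<union> I (Suc k)" for k
    using a_le[of k "Suc k"] a_le[of "Suc k" "Suc (Suc k)"] by (auto simp: I_def)
  have I_disj: "I k \<inter> I m = {}" if "k \<noteq> m" for k m
    using that a_le[of "Suc k" m] a_le[of "Suc m" k] by (cases k m rule: linorder_cases) (auto simp: I_def)
  have inf_G: "\<exists>\<^sub>F k in sequentially. X \<inter> (I k \<union> I (Suc k)) \<in> E k" if "X \<in> G" for X
  proof -
    have "(\<lambda>i. i \<in> X) \<in> N" using N(2) that by (auto simp: char_set_def)
    from inf[OF this] show ?thesis unfolding V by (simp add: Int_def conj_commute)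
  qed
  have G_up: "\<And>A A'. \<lbrakk>A \<in> G; A \<subseteq> A'\<rbrakk> \<Longrightarrow> A' \<in> G" and G_Int: "\<And>A A'. \<lbrakk>A \<in> G; A' \<in> G\<rbrakk> \<Longrightarrow> A \<inter> A' \<in> G"
    using G by (auto simp: is_filter_def)
  have far: "\<forall>\<^sub>F n in sequentially. \<forall>i\<in>U n. m \<le> i" if "\<And>n i. i \<in> U n \<Longrightarrow> a n \<le> i" for U :: "nat \<Rightarrow> nat set" and m
    using eventually_ge_at_top[of m]
    by eventually_elim (use that strict_mono_imp_increasing[OF a] in \<open>meson order_trans\<close>)
  \<comment> \<open>Conditional measures of \<open>E k\<close> given the trace on the left and on
    the right half of window \<open>k\<close>; by Markov's inequality, \<open>(1/16) ^ k\<close>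
    splits into two factors \<open>(1/4) ^ k\<close>.\<close>
  define q1 where "q1 k z = bexp ?h (I (Suc k)) (\<lambda>x. of_bool (z \<union> x \<in> E k))" for k z
  define q2 where "q2 k z = bexp ?h (I k) (\<lambda>x. of_bool (x \<union> z \<in> E k))" for k z
  have markov: "bexp ?h J (\<lambda>z. of_bool ((1/4) ^ k \<le> q z)) \<le> (1/4) ^ k"
    if "bexp ?h J q \<le> (1/16) ^ k" "\<And>z. 0 \<le> q z" for J q k
  proof -
    have "bexp ?h J (\<lambda>z. of_bool ((1/4) ^ k \<le> q z)) \<le> bexp ?h J q / (1/4) ^ k"
      using that by (intro bexp_markov) auto
    also have "\<dots> \<le> (1/16) ^ k / (1/4) ^ k" using that(1) by (intro divide_right_mono) auto
    also have "\<dots> = (1/4) ^ k" by (simp add: power_divide[symmetric])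
    finally show ?thesis .
  qed
  have q1: "bexp ?h (I k) (\<lambda>z. of_bool ((1/4) ^ k \<le> q1 k z)) \<le> (1/4) ^ k" for k
  proof (rule markov)
    have "bexp ?h (I k) (q1 k) = bexp ?h (I k \<union> I (Suc k)) (\<lambda>A. of_bool (A \<in> E k))"
      unfolding q1_def by (rule bexp_Un[symmetric]) (auto simp: I_disj)
    then show "bexp ?h (I k) (q1 k) \<le> (1/16) ^ k" using small[of k] unfolding V by simp
    show "0 \<le> q1 k z" for z unfolding q1_def by (intro bexp_nonneg) auto
  qed
  have q2: "bexp ?h (I (Suc k)) (\<lambda>z. of_bool ((1/4) ^ k \<le> q2 k z)) \<le> (1/4) ^ k" for k
  proof (rule markov)
    have "bexp ?h (I (Suc k)) (q2 k) = bexp ?h (I k) (\<lambda>x. bexp ?h (I (Suc k)) (\<lambda>z. of_bool (x \<union> z \<in> E k)))"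
      unfolding q2_def by (rule bexp_swap)
    also have "\<dots> = bexp ?h (I k \<union> I (Suc k)) (\<lambda>A. of_bool (A \<in> E k))"
      by (rule bexp_Un[symmetric]) (auto simp: I_disj)
    finally show "bexp ?h (I (Suc k)) (q2 k) \<le> (1/16) ^ k" using small[of k] unfolding V by simp
    show "0 \<le> q2 k z" for z unfolding q2_def by (intro bexp_nonneg) auto
  qed
  define W where "W j = I (3 * j + 3) \<union> I (3 * j + 4)" for j
  \<comment> \<open>The window inside \<open>W j\<close> must not be in \<open>E\<close>, and the
    windows reaching into the free intervals on the right and on the left must have small
    conditional measure.\<close>
  define Bad where "Bad j = {A. A \<in> E (3 * j + 3) \<or> (1/4) ^ (3 * j + 4) \<le> q1 (3 * j + 4) (A \<inter> I (3 * j + 4))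
     \<or> (1/4) ^ (3 * j + 2) \<le> q2 (3 * j + 2) (A \<inter> I (3 * j + 3))}" for j
  have quarter: "(1/4::real) ^ (3 * j + i) \<le> (1/4) ^ i * (1/2) ^ j" for i j
  proof -
    have "((1/4::real) ^ 3) ^ j \<le> (1/2) ^ j" by (intro power_mono) (auto simp: power3_eq_cube)
    then show ?thesis by (simp add: power_add power_mult)
  qed
  have Bad_small: "bexp ?h (W j) (\<lambda>A. of_bool (A \<in> Bad j)) \<le> (1/2) ^ j" for j
  proof -
    have "bexp ?h (W j) (\<lambda>A. of_bool (A \<in> Bad j)) \<le> bexp ?h (W j) (\<lambda>A. of_bool (A \<in> E (3 * j + 3))
       + (of_bool ((1/4) ^ (3 * j + 4) \<le> q1 (3 * j + 4) (A \<inter> I (3 * j + 4)))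
       + of_bool ((1/4) ^ (3 * j + 2) \<le> q2 (3 * j + 2) (A \<inter> I (3 * j + 3)))))"
      by (intro bexp_mono) (auto simp: Bad_def)
    also have "\<dots> = bexp ?h (W j) (\<lambda>A. of_bool (A \<in> E (3 * j + 3)))
       + (bexp ?h (W j) (\<lambda>A. of_bool ((1/4) ^ (3 * j + 4) \<le> q1 (3 * j + 4) (A \<inter> I (3 * j + 4))))
       + bexp ?h (W j) (\<lambda>A. of_bool ((1/4) ^ (3 * j + 2) \<le> q2 (3 * j + 2) (A \<inter> I (3 * j + 3)))))"
      by (simp only: bexp_add)
    also have "bexp ?h (W j) (\<lambda>A. of_bool ((1/4) ^ (3 * j + 4) \<le> q1 (3 * j + 4) (A \<inter> I (3 * j + 4)))) =
        bexp ?h (I (3 * j + 4)) (\<lambda>z. of_bool ((1/4) ^ (3 * j + 4) \<le> q1 (3 * j + 4) z))"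
      by (rule bexp_marginal) (auto simp: W_def)
    also have "bexp ?h (W j) (\<lambda>A. of_bool ((1/4) ^ (3 * j + 2) \<le> q2 (3 * j + 2) (A \<inter> I (3 * j + 3)))) =
        bexp ?h (I (3 * j + 3)) (\<lambda>z. of_bool ((1/4) ^ (3 * j + 2) \<le> q2 (3 * j + 2) z))"
      by (rule bexp_marginal) (auto simp: W_def)
    also have "bexp ?h (W j) (\<lambda>A. of_bool (A \<in> E (3 * j + 3))) \<le> (1/4) ^ (3 * j + 3)"
    proof -
      have "bexp ?h (W j) (\<lambda>A. of_bool (A \<in> E (3 * j + 3))) \<le> (1/16) ^ (3 * j + 3)"
      proof -
        have "W j = {a (3 * j + 3)..<a (3 * j + 3 + 2)}"
          unfolding V W_def by (simp only: Suc_eq_plus1 add.assoc) simp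
        then show ?thesis using small[of "3 * j + 3"] by (simp only:)
      qed
      also have "\<dots> \<le> (1/4) ^ (3 * j + 3)" by (intro power_mono) auto
      finally show ?thesis .
    qed
    also have "bexp ?h (I (3 * j + 3)) (\<lambda>z. of_bool ((1/4) ^ (3 * j + 2) \<le> q2 (3 * j + 2) z)) \<le> (1/4) ^ (3 * j + 2)"
    proof -
      have "Suc (3 * j + 2) = 3 * j + 3" by simp
      then show ?thesis using q2[of "3 * j + 2"] by (simp only:)
    qed
    finally have "bexp ?h (W j) (\<lambda>A. of_bool (A \<in> Bad j)) \<le> (1/4) ^ (3 * j + 3) + ((1/4) ^ (3 * j + 4) + (1/4) ^ (3 * j + 2))"
      using q1[of "3 * j + 4"] by linarith
    also have "\<dots> \<le> (1/4) ^ 3 * (1/2) ^ j + ((1/4) ^ 4 * (1/2) ^ j + (1/4) ^ 2 * (1/2) ^ j)"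
      by (intro add_mono quarter)
    also have "\<dots> = ((1/4) ^ 3 + (1/4) ^ 4 + (1/4) ^ 2) * (1/2) ^ j" by (simp add: algebra_simps)
    also have "\<dots> \<le> 1 * (1/2) ^ j" by (intro mult_right_mono) (simp_all add: power_numeral_reduce)
    finally show ?thesis by simp
  qed
  have W_disj: "W i \<inter> W j = {}" if "i \<noteq> j" for i j
  proof -
    have *: "3 * i + 3 \<noteq> 3 * j + 3" "3 * i + 3 \<noteq> 3 * j + 4" "3 * i + 4 \<noteq> 3 * j + 3" "3 * i + 4 \<noteq> 3 * j + 4"
      using that by presburger+
    show ?thesis unfolding W_def using *[THEN I_disj] by blast
  qed
  have "(\<forall>X\<in>G. \<exists>\<^sub>F n in sequentially. X \<inter> W n \<in> up_core (W n) (Bad n)) \<or>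
      (\<exists>Y\<in>G. \<forall>\<^sub>F n in sequentially. Y \<inter> W n \<notin> Bad n)"
    by (rule up_core_dichotomy) (fact G_up, fact W_disj)
  then consider "\<forall>X\<in>G. \<exists>\<^sub>F n in sequentially. X \<inter> W n \<in> up_core (W n) (Bad n)"
    | Y where "Y \<in> G" "\<forall>\<^sub>F n in sequentially. Y \<inter> W n \<notin> Bad n"
    by blast
  then show thesis
  proof cases
    case 1
    show thesis
    \<comment> \<open>Here the blocks \<open>W\<close> themselves work, with the upward closed core
      of \<open>Bad\<close>.\<close>
    proof (rule that[of W "\<lambda>n. up_core (W n) (Bad n)"])
      show "\<forall>\<^sub>F n in sequentially. bexp ?h (W n) (\<lambda>A. of_bool (A \<in> up_core (W n) (Bad n))) \<le> (1/2) ^ n"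
        using bexp_up_core_le Bad_small by (intro always_eventually allI) (rule order_trans)
      show "\<forall>\<^sub>F n in sequentially. \<forall>i\<in>W n. m \<le> i" for m
      proof (rule far)
        fix n i assume "i \<in> W n"
        then show "a n \<le> i" using a_le[of n "3 * n + 3"] a_le[of n "3 * n + 4"] by (auto simp: W_def I_def)
      qed
    qed (use 1 up_core_upward in \<open>auto simp: W_def\<close>)
  next
    case (2 Y)
    define U where "U j = I (3 * j + 5)" for j
    \<comment> \<open>The two windows meeting the free interval \<open>U j\<close>, with the other
      half of each fixed to the trace of \<open>Y\<close>.\<close>
    define B where "B j = {x. x \<union> Y \<inter> I (3 * j + 4) \<in> E (3 * j + 4) \<or> x \<union> Y \<inter> I (3 * j + 6) \<in> E (3 * j + 5)}" for j
    have U_disj: "U i \<inter> U j = {}" if "i \<noteq> j" for i j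
      unfolding U_def using that by (intro I_disj) simp
    have B_inf: "\<exists>\<^sub>F n in sequentially. X \<inter> U n \<in> B n" if X: "X \<in> G" for X
      unfolding frequently_sequentially
    proof
      fix m
      obtain m' where m': "\<And>n. n \<ge> m' \<Longrightarrow> Y \<inter> W n \<notin> Bad n"
        using 2(2) by (auto simp: eventually_sequentially)
      define Z where "Z = {i. if i \<in> (\<Union>j. U j) then i \<in> X else i \<in> Y}"
      have "Z \<in> G" by (rule G_up[OF G_Int[OF X 2(1)]]) (auto simp: Z_def)
      define M where "M = max m m'"
      obtain k where k: "3 * M + 6 \<le> k" "Z \<inter> (I k \<union> I (Suc k)) \<in> E k"
        using inf_G[OF \<open>Z \<in> G\<close>] unfolding frequently_sequentially by blast
      have ZX: "Z \<inter> I (3 * j + 5) = X \<inter> U j" for j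
        by (auto simp: Z_def U_def)
      have ZY: "Z \<inter> I i = Y \<inter> I i" if "\<And>j. i \<noteq> 3 * j + 5" for i
      proof -
        have "U j \<inter> I i = {}" for j unfolding U_def using that[of j] by (intro I_disj) simp
        then show ?thesis by (auto simp: Z_def)
      qed
      \<comment> \<open>The residue of \<open>k\<close> modulo 3 decides whether window
        \<open>k\<close> lies inside \<open>W j\<close>, which is impossible as \<open>Y\<close> is
        good there, or meets \<open>U j\<close> from the left or from the right.\<close>
      define j where "j = (k - 3) div 3"
      have "M \<le> j" using k(1) unfolding j_def by presburger
      then have j: "m \<le> j" "m' \<le> j" by (auto simp: M_def)
      have "k = 3 * j + 3 \<or> k = 3 * j + 4 \<or> k = 3 * j + 5"
        using k(1) unfolding j_def by presburger
      then consider "k = 3 * j + 3" | "k = 3 * j + 4" | "k = 3 * j + 5" by blast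
      then show "\<exists>n\<ge>m. X \<inter> U n \<in> B n"
      proof cases
        case 1
        have "Suc (3 * j + 3) = 3 * j + 4" by simp
        then have Zk: "Z \<inter> (I (3 * j + 3) \<union> I (3 * j + 4)) \<in> E (3 * j + 3)"
          using k(2)[unfolded 1] by (simp only:)
        have "Z \<inter> I (3 * j + 3) = Y \<inter> I (3 * j + 3)" "Z \<inter> I (3 * j + 4) = Y \<inter> I (3 * j + 4)"
          by (rule ZY; presburger)+
        then have "Y \<inter> W j \<in> E (3 * j + 3)"
          using Zk by (simp only: W_def Int_Un_distrib)
        then have False using m'[of j] j by (auto simp: Bad_def)
        then show ?thesis ..
      next
        case 2
        have "Suc (3 * j + 4) = 3 * j + 5" by simp
        then have Zk: "Z \<inter> (I (3 * j + 4) \<union> I (3 * j + 5)) \<in> E (3 * j + 4)"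
          using k(2)[unfolded 2] by (simp only:)
        have "Z \<inter> I (3 * j + 4) = Y \<inter> I (3 * j + 4)" by (rule ZY) presburger
        then have "X \<inter> U j \<union> Y \<inter> I (3 * j + 4) \<in> E (3 * j + 4)"
          using Zk ZX[of j] by (simp only: Int_Un_distrib Un_commute)
        then show ?thesis using j by (intro exI[of _ j]) (auto simp: B_def)
      next
        case 3
        have "Suc (3 * j + 5) = 3 * j + 6" by simp
        then have Zk: "Z \<inter> (I (3 * j + 5) \<union> I (3 * j + 6)) \<in> E (3 * j + 5)"
          using k(2)[unfolded 3] by (simp only:)
        have "Z \<inter> I (3 * j + 6) = Y \<inter> I (3 * j + 6)" by (rule ZY) presburger
        then have "X \<inter> U j \<union> Y \<inter> I (3 * j + 6) \<in> E (3 * j + 5)"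
          using Zk ZX[of j] by (simp only: Int_Un_distrib)
        then show ?thesis using j by (intro exI[of _ j]) (auto simp: B_def)
      qed
    qed
    have B_small: "\<forall>\<^sub>F n in sequentially. bexp ?h (U n) (\<lambda>A. of_bool (A \<in> B n)) \<le> (1/2) ^ n"
    proof -
      \<comment> \<open>The right-hand neighbour of \<open>U n\<close> belongs to
        \<open>W (Suc n)\<close>: window \<open>3 * n + 5\<close> is controlled by the
        \<open>q2\<close> clause of \<open>Bad (Suc n)\<close>.\<close>
      have "\<forall>\<^sub>F n in sequentially. Y \<inter> W (Suc n) \<notin> Bad (Suc n)"
        using 2(2) by (rule eventually_sequentially_Suc[THEN iffD2])
      with 2(2) show ?thesis
      proof eventually_elim
        case (elim n)
        have 1: "q1 (3 * n + 4) (Y \<inter> I (3 * n + 4)) \<le> (1/4) ^ (3 * n + 4)"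
        proof -
          have "Y \<inter> W n \<inter> I (3 * n + 4) = Y \<inter> I (3 * n + 4)" by (auto simp: W_def)
          then show ?thesis using elim(1) by (auto simp: Bad_def)
        qed
        have 2: "q2 (3 * n + 5) (Y \<inter> I (3 * n + 6)) \<le> (1/4) ^ (3 * n + 5)"
        proof -
          have "3 * Suc n + 2 = 3 * n + 5" "3 * Suc n + 3 = 3 * n + 6" by auto
          moreover have "Y \<inter> W (Suc n) \<inter> I (3 * Suc n + 3) = Y \<inter> I (3 * Suc n + 3)" by (auto simp: W_def)
          ultimately show ?thesis using elim(2) unfolding Bad_def by (simp only: mem_Collect_eq) linarith
        qed
        have "bexp ?h (U n) (\<lambda>A. of_bool (A \<in> B n)) \<le> bexp ?h (U n)
           (\<lambda>x. of_bool (Y \<inter> I (3 * n + 4) \<union> x \<in> E (3 * n + 4)) + of_bool (x \<union> Y \<inter> I (3 * n + 6) \<in> E (3 * n + 5)))"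
          by (intro bexp_mono) (auto simp: B_def Un_commute)
        also have "\<dots> = q1 (3 * n + 4) (Y \<inter> I (3 * n + 4)) + q2 (3 * n + 5) (Y \<inter> I (3 * n + 6))"
          by (simp add: bexp_add q1_def q2_def U_def eval_nat_numeral)
        also have "\<dots> \<le> (1/4) ^ 4 * (1/2) ^ n + (1/4) ^ 5 * (1/2) ^ n"
          using 1 2 quarter[of n 4] quarter[of n 5] by linarith
        also have "\<dots> = ((1/4) ^ 4 + (1/4) ^ 5) * (1/2) ^ n" by (simp add: algebra_simps)
        also have "\<dots> \<le> 1 * (1/2) ^ n" by (intro mult_right_mono) (simp_all add: power_numeral_reduce)
        finally show ?case by simp
      qed
    qed
    \<comment> \<open>The second alternative contradicts \<open>B_inf\<close>, so \<open>B\<close>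
      may be replaced by its upward closed core.\<close>
    have "(\<forall>X\<in>G. \<exists>\<^sub>F n in sequentially. X \<inter> U n \<in> up_core (U n) (B n)) \<or>
        (\<exists>Y\<in>G. \<forall>\<^sub>F n in sequentially. Y \<inter> U n \<notin> B n)"
      by (rule up_core_dichotomy) (fact G_up, fact U_disj)
    then have "\<forall>X\<in>G. \<exists>\<^sub>F n in sequentially. X \<inter> U n \<in> up_core (U n) (B n)"
      using B_inf by (auto simp: frequently_def)
    then show thesis
    proof (intro that[of U "\<lambda>n. up_core (U n) (B n)"])
      show "\<forall>\<^sub>F n in sequentially. bexp ?h (U n) (\<lambda>A. of_bool (A \<in> up_core (U n) (B n))) \<le> (1/2) ^ n"
        using B_small by eventually_elim (rule order_trans[OF bexp_up_core_le])
      show "\<forall>\<^sub>F n in sequentially. \<forall>i\<in>U n. m \<le> i" for m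
      proof (rule far)
        fix n i assume "i \<in> U n"
        then show "a n \<le> i" using a_le[of n "3 * n + 5"] by (auto simp: U_def I_def)
      qed
    qed (use up_core_upward in \<open>auto simp: U_def\<close>)
  qed
qed

section \<open>Nonmeasurability of the intersection\<close>

theorem theorem2p4:
  fixes p :: "nat \<Rightarrow> real" and I :: "'i set" and F :: "'i \<Rightarrow> nat set set"
  assumes MA: martin_axiom
    and p_range: "\<And>n. 0 < p n \<and> p n \<le> 1/2"
    and p_lim: "p \<longlonglongrightarrow> 0"
    and I_ne: "I \<noteq> {}"
    and I_small: "I \<prec> (UNIV::real set)"
    and F_filt: "\<And>\<xi>. \<xi> \<in> I \<Longrightarrow> nonprincipal_filter (F \<xi>)"
    and F_nonmeas: "\<And>\<xi>. \<xi> \<in> I \<Longrightarrow> \<not> measurable_wrt (mu_p p) (F \<xi>)"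
  shows "is_filter (\<Inter>\<xi>\<in>I. F \<xi>) \<and> \<not> measurable_wrt lebesgue_cantor (\<Inter>\<xi>\<in>I. F \<xi>)"
proof
  have F: "is_filter (F \<xi>)" "\<And>A. finite (- A) \<Longrightarrow> A \<in> F \<xi>" if "\<xi> \<in> I" for \<xi>
    using F_filt[OF that] by (auto simp: nonprincipal_filter_def)
  show filter: "is_filter (\<Inter>\<xi>\<in>I. F \<xi>)"
    unfolding is_filter_def
  proof (intro conjI ballI allI impI)
    \<comment> \<open>The intersection of an empty family would contain every set, including
      \<open>{}\<close>.\<close>
    show "{} \<notin> (\<Inter>\<xi>\<in>I. F \<xi>)" using F(1) I_ne by (auto simp: is_filter_def)
    show "B \<in> (\<Inter>\<xi>\<in>I. F \<xi>)" if "A \<in> (\<Inter>\<xi>\<in>I. F \<xi>)" "A \<subseteq> B" for A B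
    proof
      fix \<xi> assume "\<xi> \<in> I"
      then show "B \<in> F \<xi>" using F(1)[of \<xi>] that unfolding is_filter_def by blast
    qed
  qed (use F(1) in \<open>auto simp: is_filter_def\<close>)
  then have nonprincipal: "nonprincipal_filter (\<Inter>\<xi>\<in>I. F \<xi>)"
    using F(2) by (auto simp: nonprincipal_filter_def)
  show "\<not> measurable_wrt lebesgue_cantor (\<Inter>\<xi>\<in>I. F \<xi>)"
  proof
    assume "measurable_wrt lebesgue_cantor (\<Inter>\<xi>\<in>I. F \<xi>)"
    then obtain N where "N \<in> null_sets lebesgue_cantor" "char_set (\<Inter>\<xi>\<in>I. F \<xi>) \<subseteq> N"
      by (rule measurable_filter_null[OF nonprincipal])
    then obtain U B where U: "\<And>n. finite (U n)" "\<And>m. \<forall>\<^sub>F n in sequentially. \<forall>i\<in>U n. m \<le> i"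
      and up: "\<And>n A A'. \<lbrakk>A \<in> B n; A \<subseteq> A'; A' \<subseteq> U n\<rbrakk> \<Longrightarrow> A' \<in> B n"
      and small: "\<forall>\<^sub>F n in sequentially. bexp (\<lambda>_. 1/2) (U n) (\<lambda>A. of_bool (A \<in> B n)) \<le> (1/2) ^ n"
      and inf: "\<And>X. X \<in> (\<Inter>\<xi>\<in>I. F \<xi>) \<Longrightarrow> \<exists>\<^sub>F n in sequentially. X \<inter> U n \<in> B n"
      by (rule null_filter_blocks[OF filter]) blast
    obtain X where "\<And>\<xi>. \<xi> \<in> I \<Longrightarrow> X \<in> F \<xi>" "\<forall>\<^sub>F n in sequentially. X \<inter> U n \<notin> B n"
      by (rule intersection_avoids_blocks[where B = B, OF MA p_range p_lim I_small F_filt F_nonmeas U up small]) auto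
    then show False using inf[of X] by (auto simp: frequently_def)
  qed
qed

end
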